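(* Let $\alpha$ be the parameter of a family of very simple increasing trees, let $L(\mathcal{T}_n)$ be the label of the centroid (the one nearest to the root) in a random tree of size $n$, and let $\mathcal{L}$ be its limiting random variable (defined in the context). Then the moments of $L(\mathcal{T}_n)$ converge to those of $\mathcal{L}$: for every positive integer $m$, $$\lim_{n\to\infty}E_n(L^m)=E(\mathcal{L}^m).$$
   Context: Notation: $I_x(a,b)=\frac{1}{B(a,b)}\int_0^xt^{a-1}(1-t)^{b-1}\,dt$ is the regularised incomplete beta function, with $B(a,b)=\Gamma(a)\Gamma(b)/\Gamma(a+b)$. For real $x$ and an integer $r\ge0$, $\binom{x}{r}=x(x-1)\cdots(x-r+1)/r!$. Random trees. An increasing tree of size $n$ is a rooted tree with $n$ nodes labelled $1,\dots,n$ such that labels increase along every path leading away from the root (so the root has label $1$). A family of very simple increasing trees is given by real constants $c_1>0$ and $c_2$; put $\alpha=1+c_2/c_1>0$. The admissible cases are: $c_2=0$, $\alpha=1$ (general recursive trees); $c_2<0$, $0<\alpha<1$ (general plane-oriented trees); $c_2>0$, $\alpha=d/(d-1)$ with an integer $d\ge2$ (general $d$-ary increasing trees). A plane (i.e. ordered) increasing tree $T$ has weight $\omega(T)=\prod_v\phi_{\mathrm{outdeg}(v)}$, where $\sum_i\phi_iu^i=\phi(u)$ with $\phi(u)=\exp(c_1u)$ if $c_2=0$ and $\phi(u)=(1+c_2u)^{1+c_1/c_2}$ otherwise; a random tree $\mathcal{T}_n$ of size $n$ is drawn with probability proportional to its weight. Equivalently (ignoring the order of children), the random tree is produced by the growth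 process which starts with the root $1$ and, for $i=2,\dots,n$, attaches node $i$ as a child to an existing node of current out-degree $k$ with probability $\frac{\alpha-(\alpha-1)k}{i+\alpha-2}$. $E_n$ denotes expectation for a random tree of size $n$. Centroid. A centroid of a tree is a node minimising the sum of distances to all other nodes; equivalently, each branch at the node (maximal subtree not containing it) contains at most half of the nodes of the tree. Every tree has one centroid or two adjacent centroids; "the centroid" means the one nearest to the root. $L=L(T)$ is the label of the centroid. Limit variable. $\mathcal{L}$ takes values in the positive integers, with $$P(\mathcal{L}=k)=-\frac{1}{\alpha-1}I_{1/2}(k,\alpha)+\left(1+\frac{\alpha}{\alpha-1}\right)\binom{\alpha+k-2}{k-1}2^{-(\alpha+k-1)}$$ for $\alpha\neq1$, and $P(\mathcal{L}=k)=2^{-(k-1)}-\sum_{j\ge k}2^{-j}/j$ for $\alpha=1$ ($k\ge1$). *)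

theory Defs
  imports
    "HOL-Probability.Probability"
    "HOL-Computational_Algebra.Formal_Power_Series"
begin

datatype plane_tree = Node (label: nat) (branches: "plane_tree list")

fun labels :: "plane_tree \<Rightarrow> nat list" where
  "labels (Node l ts) = l # concat (map labels ts)"

fun increasing :: "plane_tree \<Rightarrow> bool" where
  "increasing (Node l ts) \<longleftrightarrow> (\<forall>t\<in>set ts. l < label t \<and> increasing t)"

definition increasing_trees :: "nat \<Rightarrow> plane_tree set" where
  "increasing_trees n = {T. increasing T \<and> distinct (labels T) \<and> set (labels T) = {1..n}}"

fun edges :: "plane_tree \<Rightarrow> (nat \<times> nat) set" where
  "edges (Node l ts) = (\<Union>t\<in>set ts. insert (l, label t) (edges t))"

definition very_simple :: "real \<Rightarrow> real \<Rightarrow> real \<Rightarrow> bool" where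
  "very_simple c1 c2 \<alpha> \<longleftrightarrow> c1 > 0 \<and> \<alpha> = 1 + c2 / c1 \<and>
     ((c2 = 0 \<and> \<alpha> = 1) \<or>
      (c2 < 0 \<and> 0 < \<alpha> \<and> \<alpha> < 1) \<or>
      (c2 > 0 \<and> (\<exists>d::nat. d \<ge> 2 \<and> \<alpha> = real d / (real d - 1))))"

text \<open>
  The degree-weight generating function as a formal power series:
  \<open>exp (c1 u)\<close> if \<open>c2 = 0\<close>, and \<open>(1 + c2 u) powr (1 + c1 / c2)\<close> otherwise, where
  \<^term>\<open>fps_binomial a\<close> is the series of \<open>(1 + u) powr a\<close>.
\<close>

definition degree_fps :: "real \<Rightarrow> real \<Rightarrow> real fps" where
  "degree_fps c1 c2 =
     (if c2 = 0 then fps_exp c1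
      else fps_compose (fps_binomial (1 + c1 / c2)) (fps_const c2 * fps_X))"

fun weight :: "real fps \<Rightarrow> plane_tree \<Rightarrow> real" where
  "weight \<phi> (Node l ts) = fps_nth \<phi> (length ts) * prod_list (map (weight \<phi>) ts)"

definition total_weight :: "real fps \<Rightarrow> nat \<Rightarrow> real" where
  "total_weight \<phi> n = (\<Sum>T\<in>increasing_trees n. weight \<phi> T)"

text \<open>
  For admissible parameters and \<open>n \<ge> 1\<close>, lemma \<open>pmf_random_tree\<close> below shows that the
  function passed to \<^const>\<open>embed_pmf\<close> is a probability mass function.
\<close>

definition random_tree :: "real \<Rightarrow> real \<Rightarrow> nat \<Rightarrow> plane_tree pmf" where
  "random_tree c1 c2 n = embed_pmf (\<lambda>T.
     if T \<in> increasing_trees n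
     then weight (degree_fps c1 c2) T / total_weight (degree_fps c1 c2) n else 0)"

definition tree_dist :: "plane_tree \<Rightarrow> nat \<Rightarrow> nat \<Rightarrow> nat" where
  "tree_dist T u v = (LEAST k. (u, v) \<in> (edges T \<union> (edges T)\<inverse>) ^^ k)"

definition is_centroid :: "plane_tree \<Rightarrow> nat \<Rightarrow> bool" where
  "is_centroid T c \<longleftrightarrow> is_arg_min (\<lambda>u. \<Sum>v\<in>set (labels T). tree_dist T u v)
                                (\<lambda>u. u \<in> set (labels T)) c"

text \<open>There are at most two centroids, and if there are two, they are adjacent, so exactly one of
  them is nearest to the root.\<close>

definition centroid_label :: "plane_tree \<Rightarrow> nat" where
  "centroid_label T = (ARG_MIN (tree_dist T (label T)) c. is_centroid T c)"

definition reg_inc_beta :: "real \<Rightarrow> real \<Rightarrow> real \<Rightarrow> real" where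
  "reg_inc_beta x a b = integral {0..x} (\<lambda>t. t powr (a - 1) * (1 - t) powr (b - 1)) / Beta a b"

definition limit_prob :: "real \<Rightarrow> nat \<Rightarrow> real" where
  "limit_prob \<alpha> k =
     (if \<alpha> = 1 then 2 powr (- (real k - 1)) - (\<Sum>i. 2 powr (- real (k + i)) / real (k + i))
      else - (1 / (\<alpha> - 1)) * reg_inc_beta (1/2) (real k) \<alpha> +
           (1 + \<alpha> / (\<alpha> - 1)) * ((\<alpha> + real k - 2) gchoose (k - 1)) * 2 powr (- (\<alpha> + real k - 1)))"

text \<open>
  Lemma \<open>pmf_limit_label\<close> below shows that this is the intended distribution.
\<close>

definition limit_label :: "real \<Rightarrow> nat pmf" where
  "limit_label \<alpha> = embed_pmf (\<lambda>k. if k \<ge> 1 then limit_prob \<alpha> k else 0)"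

lemma finite_bounded_trees:
  assumes "finite A"
  shows "finite {T. set (labels T) \<subseteq> A \<and> length (labels T) \<le> k}"
proof (induction k)
  case 0
  have "{T. set (labels T) \<subseteq> A \<and> length (labels T) \<le> 0} = {}"
    by (auto elim: labels.elims)
  then show ?case by (simp only: finite.emptyI)
next
  case (Suc k)
  let ?B = "{T. set (labels T) \<subseteq> A \<and> length (labels T) \<le> k}"
  have "{T. set (labels T) \<subseteq> A \<and> length (labels T) \<le> Suc k}
        \<subseteq> (\<lambda>(l, ts). Node l ts) ` (A \<times> {ts. set ts \<subseteq> ?B \<and> length ts \<le> k})"
  proof
    fix T assume T: "T \<in> {T. set (labels T) \<subseteq> A \<and> length (labels T) \<le> Suc k}"
    obtain l ts where lts: "T = Node l ts" by (cases T)
    have len: "length (concat (map labels ts)) \<le> k" using T lts by simp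
    have mem: "length (labels t) \<le> length (concat (map labels ts))" if "t \<in> set ts" for t
      using that by (induction ts) auto
    have pos: "1 \<le> length (labels t)" for t by (cases t) auto
    have "length ts \<le> length (concat (map labels ts))"
    proof (induction ts)
      case (Cons a ts)
      then show ?case using pos[of a] by simp
    qed simp
    then have "length ts \<le> k" using len by simp
    moreover have "set ts \<subseteq> ?B" using T lts mem len by fastforce
    moreover have "l \<in> A" using T lts by auto
    ultimately show "T \<in> (\<lambda>(l, ts). Node l ts) ` (A \<times> {ts. set ts \<subseteq> ?B \<and> length ts \<le> k})"
      using lts by auto
  qed
  moreover have "finite (A \<times> {ts. set ts \<subseteq> ?B \<and> length ts \<le> k})"
    using assms finite_lists_length_le[OF Suc] by simp
  ultimately show ?case by (meson finite_imageI finite_subset)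
qed

lemma finite_increasing_trees: "finite (increasing_trees n)"
proof -
  have "length (labels T) \<le> n" if "distinct (labels T)" "set (labels T) = {1..n}" for T
    using distinct_card[OF that(1)] that(2) by simp
  then have "increasing_trees n \<subseteq> {T. set (labels T) \<subseteq> {1..n} \<and> length (labels T) \<le> n}"
    by (auto simp: increasing_trees_def)
  then show ?thesis using finite_bounded_trees[of "{1..n}" n] finite_subset by blast
qed

lemma fps_nth_degree_fps:
  "fps_nth (degree_fps c1 c2) k =
     (if c2 = 0 then c1 ^ k / fact k else ((1 + c1 / c2) gchoose k) * c2 ^ k)"
  by (simp add: degree_fps_def fps_binomial_def fps_compose_linear)

lemma degree_fps_nonneg:
  assumes "very_simple c1 c2 \<alpha>"
  shows "fps_nth (degree_fps c1 c2) k \<ge> 0"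
proof -
  consider "c2 = 0" | "c2 < 0" "\<alpha> > 0" | d where "c2 > 0" "d \<ge> 2" "\<alpha> = real d / (real d - 1)"
    using assms by (auto simp: very_simple_def)
  then show ?thesis
  proof cases
    case 1
    then show ?thesis using assms by (simp add: fps_nth_degree_fps very_simple_def)
  next
    case 2
    have "((1 + c1 / c2) gchoose k) * c2 ^ k = (\<Prod>i<k. (1 + c1 / c2 - real i) * c2) / fact k"
      by (simp add: gbinomial_prod_rev prod.distrib atLeast0LessThan)
    also have "\<dots> \<ge> 0"
    proof (intro divide_nonneg_pos prod_nonneg)
      fix i
      have "c1 + c2 > 0" using assms 2 by (auto simp: very_simple_def field_simps)
      moreover have "c2 * real i \<le> 0" using 2 by (simp add: mult_nonpos_nonneg)
      moreover have "(1 + c1 / c2 - real i) * c2 = c1 + c2 - c2 * real i"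
        using 2 by (simp add: algebra_simps)
      ultimately show "(1 + c1 / c2 - real i) * c2 \<ge> 0" by linarith
    qed simp
    finally show ?thesis using 2 by (simp add: fps_nth_degree_fps)
  next
    case 3
    have c1: "c1 > 0" and "1 + c2 / c1 = real d / (real d - 1)"
      using assms 3 by (auto simp: very_simple_def)
    then have "c2 / c1 = 1 / (real d - 1)" using 3 by (simp add: field_simps)
    then have "c1 / c2 = real d - 1"
      using 3 c1 by (simp add: field_simps)
    then have "(1 + c1 / c2) gchoose k = real (d choose k)"
      by (simp add: binomial_gbinomial)
    then show ?thesis using 3 by (simp add: fps_nth_degree_fps)
  qed
qed

lemma weight_nonneg:
  assumes "\<And>k. fps_nth \<phi> k \<ge> 0"
  shows "weight \<phi> T \<ge> 0"
  by (induction T) (auto intro!: mult_nonneg_nonneg prod_list_nonneg assms)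

fun path_tree :: "nat \<Rightarrow> nat \<Rightarrow> plane_tree" where
  "path_tree l 0 = Node l []"
| "path_tree l (Suc k) = Node l [path_tree (Suc l) k]"

lemma label_path_tree [simp]: "label (path_tree l k) = l"
  by (cases k) auto

lemma labels_path_tree: "labels (path_tree l k) = [l..<l + Suc k]"
proof (induction k arbitrary: l)
  case (Suc k)
  have "[l..<l + Suc (Suc k)] = l # [Suc l..<l + Suc (Suc k)]" by (rule upt_conv_Cons) simp
  then show ?case using Suc by simp
qed simp

lemma increasing_path_tree: "increasing (path_tree l k)"
  by (induction k arbitrary: l) auto

lemma path_tree_in_increasing_trees: "path_tree 1 k \<in> increasing_trees (Suc k)"
  unfolding increasing_trees_def mem_Collect_eq labels_path_tree
  using increasing_path_tree by auto

lemma weight_path_tree: "weight \<phi> (path_tree l k) = fps_nth \<phi> 1 ^ k * fps_nth \<phi> 0"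
  by (induction k arbitrary: l) auto

lemma total_weight_pos:
  assumes "very_simple c1 c2 \<alpha>" "n \<ge> 1"
  shows "total_weight (degree_fps c1 c2) n > 0"
proof -
  let ?\<phi> = "degree_fps c1 c2"
  have "0 < c1 + c2"
  proof -
    have "\<alpha> > 0" using assms by (auto simp: very_simple_def intro!: divide_pos_pos)
    then show ?thesis using assms by (auto simp: very_simple_def field_simps)
  qed
  moreover have "fps_nth ?\<phi> 1 = c1 + c2"
    by (simp add: fps_nth_degree_fps distrib_right)
  moreover have "fps_nth ?\<phi> 0 = 1" by (simp add: fps_nth_degree_fps)
  ultimately have "fps_nth ?\<phi> 0 > 0" "fps_nth ?\<phi> 1 > 0" by simp_all
  then have "0 < weight ?\<phi> (path_tree 1 (n - 1))" by (simp add: weight_path_tree)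
  also have "\<dots> \<le> total_weight ?\<phi> n" unfolding total_weight_def
    using assms path_tree_in_increasing_trees[of "n - 1"]
    by (intro member_le_sum weight_nonneg finite_increasing_trees degree_fps_nonneg[OF assms(1)]) auto
  finally show ?thesis .
qed

lemma pmf_random_tree:
  assumes "very_simple c1 c2 \<alpha>" "n \<ge> 1"
  shows "pmf (random_tree c1 c2 n) T =
    (if T \<in> increasing_trees n
     then weight (degree_fps c1 c2) T / total_weight (degree_fps c1 c2) n else 0)"
  unfolding random_tree_def
proof (rule pmf_embed_pmf)
  let ?w = "weight (degree_fps c1 c2)" and ?S = "total_weight (degree_fps c1 c2) n"
  let ?f = "\<lambda>T. if T \<in> increasing_trees n then ?w T / ?S else 0"
  have w: "?w T \<ge> 0" for T by (intro weight_nonneg degree_fps_nonneg[OF assms(1)])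
  have S: "?S > 0" by (rule total_weight_pos[OF assms])
  show "0 \<le> ?f T" for T using w S by simp
  have "(\<integral>\<^sup>+ T. ennreal (?f T) \<partial>count_space UNIV) = (\<Sum>T\<in>increasing_trees n. ennreal (?f T))"
    by (rule nn_integral_count_space') (auto simp: finite_increasing_trees)
  also have "\<dots> = ennreal (\<Sum>T\<in>increasing_trees n. ?f T)"
    using w S by (intro sum_ennreal) auto
  also have "(\<Sum>T\<in>increasing_trees n. ?f T) = ?S / ?S"
    by (simp add: sum_divide_distrib[symmetric] flip: total_weight_def)
  finally show "(\<integral>\<^sup>+ T. ennreal (?f T) \<partial>count_space UNIV) = 1" using S by simp
qed

lemma gchoose_shift: "(\<alpha> + real n - 1) gchoose n = pochhammer \<alpha> n / fact n" for \<alpha> :: real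
  by (simp add: gbinomial_pochhammer')

lemma gchoose_shift_nonneg: "\<alpha> > 0 \<Longrightarrow> (\<alpha> + real n - 1) gchoose n \<ge> 0" for \<alpha> :: real
  by (simp add: gchoose_shift pochhammer_nonneg)

lemma gchoose_shift_sums:
  fixes \<alpha> t :: real
  assumes "\<bar>t\<bar> < 1"
  shows "(\<lambda>n. ((\<alpha> + real n - 1) gchoose n) * t ^ n) sums (1 - t) powr (- \<alpha>)"
proof -
  have "((- \<alpha>) gchoose n) * (- t) ^ n = ((\<alpha> + real n - 1) gchoose n) * t ^ n" for n
    by (simp add: gbinomial_minus power_minus[of t])
  then show ?thesis using gen_binomial_real[of "- t" "- \<alpha>"] assms by simp
qed

text \<open>
  Integrating by parts, the limit probability at \<open>n + 1\<close> becomes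
  \<open>((\<alpha> + n - 1) gchoose n) * (2 * 2 powr - (\<alpha> + n) - half_int \<alpha> n)\<close>, for \<open>\<alpha> = 1\<close> as well. Both
  parts can be summed over \<open>n\<close> by the binomial series, giving \<open>2 - 1\<close>.
\<close>

definition half_int :: "real \<Rightarrow> nat \<Rightarrow> real" where
  "half_int \<alpha> n = integral {0..1/2} (\<lambda>t. t ^ n * (1 - t) powr (\<alpha> - 2))"

lemma half_int_has_integral:
  "((\<lambda>t. t ^ n * (1 - t) powr (\<alpha> - 2)) has_integral half_int \<alpha> n) {0..1/2}"
  unfolding half_int_def
  by (intro integrable_integral integrable_continuous_real continuous_intros) auto

lemma power_has_integral_half: "((\<lambda>t::real. t ^ n) has_integral (1/2) ^ Suc n / Suc n) {0..1/2}"
proof -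
  have "((\<lambda>t::real. t ^ n) has_integral ((1/2) ^ Suc n / Suc n - 0 ^ Suc n / Suc n)) {0..1/2}"
    by (rule fundamental_theorem_of_calculus)
       (auto intro!: derivative_eq_intros simp flip: has_real_derivative_iff_has_vector_derivative
             simp del: power_Suc)
  then show ?thesis by simp
qed

lemma half_int_nonneg: "half_int \<alpha> n \<ge> 0"
  by (rule has_integral_nonneg[OF half_int_has_integral]) auto

lemma half_int_le:
  assumes "\<alpha> \<le> 2"
  shows "half_int \<alpha> n \<le> 2 * 2 powr (- (\<alpha> + real n)) / Suc n"
proof -
  have "half_int \<alpha> n \<le> (1/2) powr (\<alpha> - 2) * ((1/2) ^ Suc n / Suc n)"
  proof (rule has_integral_le[OF half_int_has_integral])
    show "((\<lambda>t. (1/2) powr (\<alpha> - 2) * t ^ n) has_integral (1/2) powr (\<alpha> - 2) * ((1/2) ^ Suc n / Suc n)) {0..1/2}"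
      by (intro has_integral_mult_right power_has_integral_half)
    fix t :: real assume t: "t \<in> {0..1/2}"
    have "(1 - t) powr (\<alpha> - 2) \<le> (1/2) powr (\<alpha> - 2)"
      using t assms by (intro powr_mono2') auto
    then show "t ^ n * (1 - t) powr (\<alpha> - 2) \<le> (1/2) powr (\<alpha> - 2) * t ^ n"
      using t by (subst mult.commute) (intro mult_right_mono, auto)
  qed
  also have "(1/2) powr (\<alpha> - 2) * (1/2) ^ Suc n = 2 * 2 powr (- (\<alpha> + real n))"
  proof -
    have "(1/2::real) powr (\<alpha> - 2) * (1/2) ^ Suc n = (1/2) powr (\<alpha> - 2) * (1/2) powr real (Suc n)"
      by (subst powr_realpow) auto
    also have "\<dots> = (1/2) powr (\<alpha> + real n - 1)" by (simp add: algebra_simps flip: powr_add)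
    also have "\<dots> = 2 powr (- (\<alpha> + real n - 1))"
      by (simp only: powr_minus_divide powr_divide) simp
    also have "- (\<alpha> + real n - 1) = 1 + - (\<alpha> + real n)" by simp
    also have "2 powr (1 + - (\<alpha> + real n)) = 2 * 2 powr (- (\<alpha> + real n))"
      by (subst powr_add) simp
    finally show ?thesis .
  qed
  then have "(1/2) powr (\<alpha> - 2) * ((1/2) ^ Suc n / Suc n) = 2 * 2 powr (- (\<alpha> + real n)) / Suc n"
    by (metis times_divide_eq_right)
  finally show ?thesis .
qed

lemma reg_inc_beta_half:
  assumes "\<alpha> > 0"
  shows "reg_inc_beta (1/2) (real (Suc n)) \<alpha> =
    ((\<alpha> + real n - 1) gchoose n) * (2 powr (- (\<alpha> + real n)) + (\<alpha> - 1) * half_int \<alpha> n)"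
proof -
  let ?I = "integral {0..1/2} (\<lambda>t. t powr (real (Suc n) - 1) * (1 - t) powr (\<alpha> - 1))"
  let ?G = "\<lambda>t::real. t ^ n * (1 - t) powr (\<alpha> - 1)"
  have I: "?I = integral {0..1/2} ?G"
    by (rule integral_spike[of "{0}"]) (auto simp: powr_realpow)
  have G: "(?G has_integral ?I) {0..1/2}" unfolding I
    by (intro integrable_integral integrable_continuous_real continuous_intros) auto
  let ?F = "\<lambda>t::real. t ^ Suc n * (1 - t) powr (\<alpha> - 1)"
  have "((\<lambda>t. (\<alpha> + real n) * ?G t - (\<alpha> - 1) * (t ^ n * (1 - t) powr (\<alpha> - 2)))
          has_integral ?F (1/2) - ?F 0) {0..1/2}"
  proof (rule fundamental_theorem_of_calculus)
    fix t :: real assume t: "t \<in> {0..1/2}"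
    have p: "(1 - t) powr (\<alpha> - 1) = (1 - t) * (1 - t) powr (\<alpha> - 2)"
    proof -
      have "(1 - t) powr (\<alpha> - 1) = (1 - t) powr (1 + (\<alpha> - 2))" by simp
      also have "\<dots> = (1 - t) * (1 - t) powr (\<alpha> - 2)" using t by (subst powr_add) auto
      finally show ?thesis .
    qed
    have "(?F has_real_derivative
        real (Suc n) * t ^ n * (1 - t) powr (\<alpha> - 1) - t ^ Suc n * ((\<alpha> - 1) * (1 - t) powr (\<alpha> - 2)))
        (at t within {0..1/2})"
      using t by (auto intro!: derivative_eq_intros simp del: power_Suc)
    also have "real (Suc n) * t ^ n * (1 - t) powr (\<alpha> - 1) - t ^ Suc n * ((\<alpha> - 1) * (1 - t) powr (\<alpha> - 2))
      = (\<alpha> + real n) * ?G t - (\<alpha> - 1) * (t ^ n * (1 - t) powr (\<alpha> - 2))"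
      unfolding p by (simp add: algebra_simps)
    finally show "(?F has_vector_derivative
        (\<alpha> + real n) * ?G t - (\<alpha> - 1) * (t ^ n * (1 - t) powr (\<alpha> - 2))) (at t within {0..1/2})"
      by (simp add: has_real_derivative_iff_has_vector_derivative)
  qed simp
  moreover have "((\<lambda>t. (\<alpha> + real n) * ?G t - (\<alpha> - 1) * (t ^ n * (1 - t) powr (\<alpha> - 2)))
          has_integral (\<alpha> + real n) * ?I - (\<alpha> - 1) * half_int \<alpha> n) {0..1/2}"
    by (intro has_integral_diff has_integral_mult_right G half_int_has_integral)
  ultimately have "(\<alpha> + real n) * ?I - (\<alpha> - 1) * half_int \<alpha> n = ?F (1/2) - ?F 0"
    using has_integral_unique by blast
  also have "\<dots> = 2 powr (- (\<alpha> + real n))"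
  proof -
    have "(1/2::real) ^ Suc n * (1/2) powr (\<alpha> - 1) = (1/2) powr real (Suc n) * (1/2) powr (\<alpha> - 1)"
      by (subst powr_realpow) auto
    also have "\<dots> = (1/2) powr (\<alpha> + real n)" by (simp add: algebra_simps flip: powr_add)
    also have "\<dots> = 2 powr (- (\<alpha> + real n))" by (simp add: powr_divide powr_minus_divide[symmetric])
    finally show ?thesis by simp
  qed
  finally have "(\<alpha> + real n) * ?I = 2 powr (- (\<alpha> + real n)) + (\<alpha> - 1) * half_int \<alpha> n" by simp
  moreover have "1 / Beta (real (Suc n)) \<alpha> = ((\<alpha> + real n - 1) gchoose n) * (\<alpha> + real n)"
  proof -
    have nz: "\<alpha> \<notin> \<int>\<^sub>\<le>\<^sub>0" "\<alpha> + real n \<notin> \<int>\<^sub>\<le>\<^sub>0" using assms by (auto elim!: nonpos_Ints_cases)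
    have "Beta (real (Suc n)) \<alpha> = fact n * Gamma \<alpha> / Gamma (\<alpha> + real n + 1)"
      using Gamma_fact[of n, where 'a = real] by (simp add: Beta_def add_ac)
    also have "Gamma (\<alpha> + real n + 1) = (\<alpha> + real n) * Gamma (\<alpha> + real n)"
      using nz by (intro Gamma_plus1)
    also have "Gamma (\<alpha> + real n) = pochhammer \<alpha> n * Gamma \<alpha>"
      using pochhammer_Gamma[OF nz(1), of n] Gamma_real_pos[OF assms] by simp
    finally show ?thesis using Gamma_real_pos[OF assms] by (simp add: gchoose_shift)
  qed
  moreover have "reg_inc_beta (1/2) (real (Suc n)) \<alpha> = ?I * (1 / Beta (real (Suc n)) \<alpha>)"
    unfolding reg_inc_beta_def by (simp only: times_divide_eq_right mult_1_right)
  moreover have "?I * (C * a) = C * (a * ?I)" for C a by (simp only: mult_ac)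
  ultimately show ?thesis by (simp only:)
qed

lemma log_tail_eq_half_int:
  "(\<lambda>i. 2 powr (- real (Suc n + i)) / real (Suc n + i)) sums half_int 1 n"
proof -
  have rec: "half_int 1 k - half_int 1 (Suc k) = 2 powr (- real (Suc k)) / real (Suc k)" for k
  proof -
    have "((\<lambda>t. t ^ k * (1 - t) powr (1 - 2) - t ^ Suc k * (1 - t) powr (1 - 2))
            has_integral half_int 1 k - half_int 1 (Suc k)) {0..1/2}"
      by (intro has_integral_diff half_int_has_integral)
    then have "((\<lambda>t. t ^ k) has_integral half_int 1 k - half_int 1 (Suc k)) {0..1/2::real}"
    proof (rule has_integral_eq[rotated])
      fix t :: real assume "t \<in> {0..1/2}"
      then have "(1 - t) * (1 - t) powr (1 - 2) = 1" by (simp add: powr_minus)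
      moreover have "t ^ k * (1 - t) powr (1 - 2) - t ^ Suc k * (1 - t) powr (1 - 2)
          = t ^ k * ((1 - t) * (1 - t) powr (1 - 2))"
        by (simp only: power_Suc left_diff_distrib right_diff_distrib mult_1_left mult.assoc mult.left_commute)
      ultimately show "t ^ k * (1 - t) powr (1 - 2) - t ^ Suc k * (1 - t) powr (1 - 2) = t ^ k"
        by (simp only: mult_1_right)
    qed
    then have "half_int 1 k - half_int 1 (Suc k) = (1/2) ^ Suc k / real (Suc k)"
      using power_has_integral_half has_integral_unique by blast
    also have "(1/2::real) ^ Suc k = 2 powr (- real (Suc k))"
      by (simp only: powr_minus powr_realpow power_one_over inverse_eq_divide zero_less_numeral)
    finally show ?thesis .
  qed
  have "(\<lambda>k. half_int 1 k) \<longlonglongrightarrow> 0"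
  proof (rule tendsto_sandwich[where f = "\<lambda>_. 0" and h = "\<lambda>k. 2 / real (Suc k)"])
    show "eventually (\<lambda>k. half_int 1 k \<le> 2 / real (Suc k)) sequentially"
    proof (intro always_eventually allI)
      fix k
      have "2 powr (- (1 + real k)) \<le> (2::real) powr 0" by (intro powr_mono) auto
      then have "2 * 2 powr (- (1 + real k)) / Suc k \<le> 2 / Suc k" by (intro divide_right_mono) auto
      then show "half_int 1 k \<le> 2 / real (Suc k)" using half_int_le[of 1 k] by simp
    qed
    show "(\<lambda>k. 2 / real (Suc k)) \<longlonglongrightarrow> 0" by (rule LIMSEQ_Suc[OF lim_const_over_n])
  qed (auto simp: half_int_nonneg)
  then have "(\<lambda>i. half_int 1 (i + n)) \<longlonglongrightarrow> 0" by (rule LIMSEQ_ignore_initial_segment)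
  from telescope_sums'[OF this] show ?thesis
    using rec[of "_ + n"] by (simp add: add_ac)
qed

lemma limit_prob_Suc:
  assumes "\<alpha> > 0"
  shows "limit_prob \<alpha> (Suc n) =
    ((\<alpha> + real n - 1) gchoose n) * (2 * 2 powr (- (\<alpha> + real n)) - half_int \<alpha> n)"
proof (cases "\<alpha> = 1")
  case True
  have "2 * 2 powr (- (1 + real n)) = (2::real) powr (1 + - (1 + real n))" by (subst powr_add) simp
  then have "2 * 2 powr (- (1 + real n)) = (2::real) powr - real n" by simp
  moreover have "(1 + real n - 1) gchoose n = 1" by (simp flip: binomial_gbinomial)
  ultimately show ?thesis using True sums_unique[OF log_tail_eq_half_int[of n]]
    by (simp add: limit_prob_def)
next
  case False
  define C where "C = ((\<alpha> + real n - 1) gchoose n)"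
  define q where "q = 2 powr (- (\<alpha> + real n))"
  have e: "\<alpha> + real (Suc n) - 2 = \<alpha> + real n - 1" "\<alpha> + real (Suc n) - 1 = \<alpha> + real n" by auto
  have "limit_prob \<alpha> (Suc n) =
      - (1 / (\<alpha> - 1)) * (C * (q + (\<alpha> - 1) * half_int \<alpha> n)) + (1 + \<alpha> / (\<alpha> - 1)) * C * q"
    unfolding limit_prob_def reg_inc_beta_half[OF assms] e using False by (simp add: C_def q_def)
  also have "\<dots> = C * (2 * q - half_int \<alpha> n)"
  proof -
    define r where "r = 1 / (\<alpha> - 1)"
    have r: "r * (\<alpha> - 1) = 1" "\<alpha> / (\<alpha> - 1) = 1 + r"
      using False by (simp_all add: r_def field_simps)
    have "- r * (C * (q + (\<alpha> - 1) * half_int \<alpha> n)) + (1 + (1 + r)) * C * q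
        = C * (2 * q - (r * (\<alpha> - 1)) * half_int \<alpha> n)" by (simp add: algebra_simps)
    then show ?thesis unfolding r(2) r(1) by (simp add: r_def)
  qed
  finally show ?thesis by (simp add: C_def q_def)
qed

lemma very_simple_bounds:
  assumes "very_simple c1 c2 \<alpha>"
  shows "0 < \<alpha>" "\<alpha> \<le> 2"
proof -
  have d: "0 < real d / (real d - 1) \<and> real d / (real d - 1) \<le> 2" if "2 \<le> d" for d
    using that by (auto simp: field_simps)
  consider "\<alpha> = 1" | "0 < \<alpha>" "\<alpha> < 1" | d where "2 \<le> d" "\<alpha> = real d / (real d - 1)"
    using assms unfolding very_simple_def by blast
  then have "0 < \<alpha> \<and> \<alpha> \<le> 2"
  proof cases
    case (3 d)
    then show ?thesis using d[OF 3(1)] by (simp only:)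
  qed simp_all
  then show "0 < \<alpha>" "\<alpha> \<le> 2" by simp_all
qed

lemma limit_prob_nonneg:
  assumes "0 < \<alpha>" "\<alpha> \<le> 2"
  shows "limit_prob \<alpha> (Suc n) \<ge> 0"
proof -
  have "half_int \<alpha> n \<le> 2 * 2 powr (- (\<alpha> + real n)) / Suc n" by (rule half_int_le[OF assms(2)])
  also have "\<dots> \<le> 2 * 2 powr (- (\<alpha> + real n)) / 1" by (intro divide_left_mono) auto
  finally show ?thesis using gchoose_shift_nonneg[OF assms(1)] by (simp add: limit_prob_Suc[OF assms(1)])
qed

lemma limit_prob_sums:
  assumes "0 < \<alpha>"
  shows "(\<lambda>n. limit_prob \<alpha> (Suc n)) sums 1"
proof -
  let ?C = "\<lambda>n. (\<alpha> + real n - 1) gchoose n"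
  have "(\<lambda>n. ?C n * (1/2) ^ n * (2 * 2 powr (- \<alpha>))) sums ((1 - 1/2) powr (- \<alpha>) * (2 * 2 powr (- \<alpha>)))"
    by (intro sums_mult2 gchoose_shift_sums) auto
  moreover have "?C n * (1/2) ^ n * (2 * 2 powr (- \<alpha>)) = ?C n * (2 * 2 powr (- (\<alpha> + real n)))" for n
    by (simp add: powr_diff powr_realpow power_one_over)
  moreover have "(1 - 1/2) powr (- \<alpha>) * (2 * 2 powr (- \<alpha>)) = 2"
    by (simp add: powr_minus powr_divide)
  ultimately have A: "(\<lambda>n. ?C n * (2 * 2 powr (- (\<alpha> + real n)))) sums 2" by (simp only:)

  let ?g = "\<lambda>n t. ?C n * (t ^ n * (1 - t) powr (\<alpha> - 2))"
  have I: "(\<integral>\<^sup>+ t. ennreal (?g n t) * indicator {0..1/2} t \<partial>lborel) = ennreal (?C n * half_int \<alpha> n)" for n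
    using gchoose_shift_nonneg[OF assms, of n]
    by (intro nn_integral_has_integral_lebesgue' has_integral_mult_right half_int_has_integral) auto
  have "(\<Sum>n. ennreal (?C n * half_int \<alpha> n))
      = (\<integral>\<^sup>+ t. (\<Sum>n. ennreal (?g n t) * indicator {0..1/2} t) \<partial>lborel)"
    unfolding I[symmetric] by (rule nn_integral_suminf[symmetric]) auto
  also have "\<dots> = (\<integral>\<^sup>+ t. ennreal (1 / (1 - t)\<^sup>2) * indicator {0..1/2::real} t \<partial>lborel)"
  proof (rule nn_integral_cong)
    fix t :: real
    show "(\<Sum>n. ennreal (?g n t) * indicator {0..1/2} t)
        = ennreal (1 / (1 - t)\<^sup>2) * indicator {0..1/2::real} t"
    proof (cases "t \<in> {0..1/2}")
      case True
      have "(\<lambda>n. ?C n * t ^ n * (1 - t) powr (\<alpha> - 2)) sums ((1 - t) powr (- \<alpha>) * (1 - t) powr (\<alpha> - 2))"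
        using True by (intro sums_mult2 gchoose_shift_sums) auto
      also have "(1 - t) powr (- \<alpha>) * (1 - t) powr (\<alpha> - 2) = 1 / (1 - t)\<^sup>2"
      proof -
        have "(1 - t) powr (- \<alpha>) * (1 - t) powr (\<alpha> - 2) = (1 - t) powr (- \<alpha> + (\<alpha> - 2))"
          by (rule powr_add[symmetric])
        also have "\<dots> = 1 / (1 - t) powr 2" by (simp add: powr_minus_divide)
        finally show ?thesis using True by simp
      qed
      finally have "(\<lambda>n. ?g n t) sums (1 / (1 - t)\<^sup>2)" by (simp only: mult.assoc)
      moreover have "?g n t \<ge> 0" for n using True gchoose_shift_nonneg[OF assms, of n] by auto
      ultimately have "(\<Sum>n. ennreal (?g n t)) = ennreal (1 / (1 - t)\<^sup>2)"
        by (intro suminf_ennreal_eq)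
      then show ?thesis using True by simp
    qed simp
  qed
  also have "\<dots> = ennreal 1"
  proof (rule nn_integral_has_integral_lebesgue')
    have "((\<lambda>t. 1 / (1 - t)\<^sup>2) has_integral 1 / (1 - 1/2) - 1 / (1 - 0)) {0..1/2::real}"
      by (rule fundamental_theorem_of_calculus)
         (auto intro!: derivative_eq_intros simp: power2_eq_square
               simp flip: has_real_derivative_iff_has_vector_derivative)
    then show "((\<lambda>t. 1 / (1 - t)\<^sup>2) has_integral 1) {0..1/2::real}" by simp
  qed auto
  finally have S: "(\<Sum>n. ennreal (?C n * half_int \<alpha> n)) = ennreal 1" .
  have nn: "?C n * half_int \<alpha> n \<ge> 0" for n
    using gchoose_shift_nonneg[OF assms, of n] half_int_nonneg by simp
  then have "summable (\<lambda>n. ?C n * half_int \<alpha> n)"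
    using S by (intro summable_suminf_not_top) auto
  then have B: "(\<lambda>n. ?C n * half_int \<alpha> n) sums 1"
  proof -
    assume sm: "summable (\<lambda>n. ?C n * half_int \<alpha> n)"
    have "ennreal (\<Sum>n. ?C n * half_int \<alpha> n) = ennreal 1"
      using suminf_ennreal2[OF nn sm] S by simp
    then have "(\<Sum>n. ?C n * half_int \<alpha> n) = 1"
      using suminf_nonneg[OF sm nn] by (subst (asm) ennreal_inj) auto
    then show ?thesis using summable_sums[OF sm] by simp
  qed
  have "(\<lambda>n. ?C n * (2 * 2 powr (- (\<alpha> + real n))) - ?C n * half_int \<alpha> n) sums (2 - 1)"
    by (rule sums_diff[OF A B])
  then show ?thesis by (simp only: limit_prob_Suc[OF assms] right_diff_distrib) simp
qed

lemma pmf_limit_label: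
  assumes "very_simple c1 c2 \<alpha>"
  shows "pmf (limit_label \<alpha>) k = (if k \<ge> 1 then limit_prob \<alpha> k else 0)"
  unfolding limit_label_def
proof (rule pmf_embed_pmf)
  note \<alpha> = very_simple_bounds[OF assms]
  let ?f = "\<lambda>k. if k \<ge> 1 then limit_prob \<alpha> k else 0"
  show nn: "0 \<le> ?f k" for k using limit_prob_nonneg[OF \<alpha>, of "k - 1"] by auto
  have "?f sums 1"
    using limit_prob_sums[OF \<alpha>(1)] sums_Suc[of ?f 1] by simp
  then have "(\<Sum>k. ennreal (?f k)) = ennreal 1"
    by (rule suminf_ennreal_eq[OF nn])
  then show "(\<integral>\<^sup>+ k. ennreal (?f k) \<partial>count_space UNIV) = 1"
    by (simp only: nn_integral_count_space_nat ennreal_1)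
qed

end

theory Submission
  imports Defs "HOL-Real_Asymp.Real_Asymp"
begin

text \<open>
  The weights are such that cutting off the node with the largest label relates trees of size \<open>n + 1\<close>
  and \<open>n\<close> in a simple way: a new leaf fits under a node of outdegree \<open>d\<close> in \<open>d + 1\<close> positions, and
  these positions together multiply the weight of the tree by \<open>c1 * (\<alpha> - (\<alpha> - 1) * d)\<close>. A random tree
  is therefore grown node by node, and since the centroid does not depend on the order of children,
  only the edges matter (\<open>edge_mean_Suc\<close>).

  Let \<open>S v\<close> be the number of nodes of the subtree at \<open>v\<close>. The sum of distances from \<open>u\<close> to all nodes is,
  up to a constant, the sum of \<open>n - 2 * S v\<close> over the ancestors \<open>v\<close> of \<open>u\<close>. Hence the centroid nearest
  to the root is the last node of the chain of all nodes with \<open>S v > n / 2\<close> (\<open>centroid_label_eq\<close>), and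
  it equals \<open>k\<close> iff \<open>S k > n / 2\<close> and no child of \<open>k\<close> has this property. As at most one child has it,
  the probability of \<open>L = k\<close> is the probability of \<open>S k > n / 2\<close> minus the expected number of
  children \<open>j\<close> of \<open>k\<close> with \<open>S j > n / 2\<close> (\<open>centroid_indicator\<close>). Both depend only on laws of single subtree sizes.

  A subtree of size \<open>s\<close> receives the next node with probability \<open>(s + \<alpha> - 1) / (n + \<alpha> - 1)\<close>, so
  subtree sizes are Polya urns with explicit laws (\<open>mean_subtree_size\<close>, \<open>mean_child_sizes\<close>). Summed over
  all sizes above \<open>n div 2\<close> they telescope, first in the size and then in the label: the probability of
  \<open>L = k\<close> is \<open>b k - (\<Sum>l\<ge>k. b (l + 1) / (l + \<alpha> - 1))\<close>, where with \<open>c i = pochhammer \<alpha> i / i!\<close> and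
  \<open>h = n div 2\<close>

    \<open>b (i + 1) = c i * (c h / c (n - 1)) * ((n - 1 - h) choose i) / ((n - 1) choose i)\<close>.

  For \<open>n \<longrightarrow> \<infinity>\<close> this tends to \<open>v i = c i * 2 powr (1 - \<alpha> - i)\<close>, and it is at most a constant times
  \<open>(i + 1) * 2 powr (- i)\<close>, uniformly in \<open>n\<close> (\<open>boundary_term0_bound\<close>). Tannery's theorem then gives the
  limit of each probability, and once more the limit of the moments. That the limit
  \<open>v i - (\<Sum>l\<ge>i. v (l + 1) / (l + \<alpha>))\<close> is the prescribed probability of \<open>i + 1\<close> follows from a recurrence
  for the incomplete beta integral (\<open>limit_prob_series\<close>).
\<close>

section \<open>Growing a plane tree by a leaf\<close>

fun insertions :: "'a \<Rightarrow> 'a list \<Rightarrow> 'a list list" where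
  "insertions a [] = [[a]]"
| "insertions a (b # bs) = (a # b # bs) # map ((#) b) (insertions a bs)"

text \<open>
  Every result comes with the label of the parent of the new leaf \<open>x\<close>, since the parent determines both
  the weight and the edges of the result. In a forest the leaf is put below one of the trees, never
  beside them.
\<close>

fun grow :: "nat \<Rightarrow> plane_tree \<Rightarrow> (nat \<times> plane_tree) list"
  and grow_forest :: "nat \<Rightarrow> plane_tree list \<Rightarrow> (nat \<times> plane_tree list) list" where
  "grow x (Node l ts) = map (\<lambda>us. (l, Node l us)) (insertions (Node x []) ts) @
     map (\<lambda>(v, us). (v, Node l us)) (grow_forest x ts)"
| "grow_forest x [] = []"
| "grow_forest x (t # ts) = map (\<lambda>(v, u). (v, u # ts)) (grow x t) @
     map (\<lambda>(v, us). (v, t # us)) (grow_forest x ts)"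

lemma length_insertions: "length (insertions a bs) = Suc (length bs)"
  by (induction bs) auto

lemma mem_insertions: "us @ a # vs \<in> set (insertions a (us @ vs))"
proof (induction us)
  case Nil
  then show ?case by (cases vs) auto
qed auto

lemma mset_insertions: "cs \<in> set (insertions a bs) \<Longrightarrow> mset cs = add_mset a (mset bs)"
  by (induction bs arbitrary: cs) auto

lemma distinct_insertions: "a \<notin> set bs \<Longrightarrow> distinct (insertions a bs)"
  by (induction bs) (auto simp: distinct_map)

lemma mset_concat_map:
  "mset (concat (map f xs)) = (\<Sum>x\<in>#mset xs. mset (f x))"
  by (induction xs) auto

text \<open>
  The labels are compared as multisets so that distinctness can be transferred in both directions.
\<close>

lemma grow_structure:
  shows "(v, T') \<in> set (grow x T) \<Longrightarrow>
      label T' = label T \<and> edges T' = insert (v, x) (edges T) \<and>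
      mset (labels T') = add_mset x (mset (labels T)) \<and> v \<in> set (labels T)"
    and "(v, ts') \<in> set (grow_forest x ts) \<Longrightarrow>
      map label ts' = map label ts \<and>
      (\<Union>t\<in>set ts'. edges t) = insert (v, x) (\<Union>t\<in>set ts. edges t) \<and>
      mset (concat (map labels ts')) = add_mset x (mset (concat (map labels ts))) \<and>
      v \<in> set (concat (map labels ts))"
proof (induction x T and x ts arbitrary: v T' and v ts' rule: grow_grow_forest.induct)
  case (1 x l ts)
  from "1.prems" consider us where "us \<in> set (insertions (Node x []) ts)" "v = l" "T' = Node l us"
    | us where "(v, us) \<in> set (grow_forest x ts)" "T' = Node l us"
    by auto
  then show ?case
  proof cases
    case 1
    from mset_insertions[OF 1(1)] have m: "mset us = add_mset (Node x []) (mset ts)" .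
    then have "set us = insert (Node x []) (set ts)" by (metis set_mset_mset set_mset_add_mset_insert)
    then show ?thesis using 1 m by (auto simp: mset_concat_map simp del: mset_concat)
  next
    case 2
    note IH = "1.IH"[OF 2(1)]
    have e: "edges (Node l ts) = Pair l ` set (map label ts) \<union> (\<Union>t\<in>set ts. edges t)" for ts
      by auto
    show ?thesis using IH unfolding 2 e by (auto simp del: edges.simps)
  qed
next
  case (3 x t ts)
  from "3.prems" consider u where "(v, u) \<in> set (grow x t)" "ts' = u # ts"
    | us where "(v, us) \<in> set (grow_forest x ts)" "ts' = t # us"
    by auto
  then show ?case
  proof cases
    case 1
    then show ?thesis using "3.IH"(1)[OF 1(1)] by simp
  next
    case 2
    then show ?thesis using "3.IH"(2)[OF 2(1)] by simp
  qed
qed auto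

lemma label_in_labels: "label T \<in> set (labels T)"
  by (cases T) auto

lemma label_least:
  assumes "increasing T" "v \<in> set (labels T)" shows "label T \<le> v"
  using assms
proof (induction T arbitrary: v)
  case (Node l ts)
  show ?case
  proof (cases "v = l")
    case False
    then obtain t where t: "t \<in> set ts" "v \<in> set (labels t)" using Node.prems(2) by auto
    then have "label t \<le> v" "l < label t" using Node by auto
    then show ?thesis by simp
  qed simp
qed

text \<open>
  An equivalence, because trees are later also traced back from size \<open>n + 1\<close> to size \<open>n\<close>.
\<close>

lemma grow_increasing:
  shows "(v, T') \<in> set (grow x T) \<Longrightarrow> \<forall>l\<in>set (labels T). l < x \<Longrightarrow>
      increasing T' \<longleftrightarrow> increasing T"
    and "(v, ts') \<in> set (grow_forest x ts) \<Longrightarrow> \<forall>l\<in>set (concat (map labels ts)). l < x \<Longrightarrow>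
      (\<forall>t\<in>set ts'. increasing t) \<longleftrightarrow> (\<forall>t\<in>set ts. increasing t)"
proof (induction x T and x ts arbitrary: v T' and v ts' rule: grow_grow_forest.induct)
  case (1 x l ts)
  from "1.prems"(1) consider us where "us \<in> set (insertions (Node x []) ts)" "v = l" "T' = Node l us"
    | us where "(v, us) \<in> set (grow_forest x ts)" "T' = Node l us"
    by auto
  then show ?case
  proof cases
    case 1
    from mset_insertions[OF 1(1)] have "set us = insert (Node x []) (set ts)"
      by (metis set_mset_mset set_mset_add_mset_insert)
    then show ?thesis using 1(2,3) "1.prems"(2) by auto
  next
    case 2
    have "map label us = map label ts" (is "?us = ?ts") using grow_structure(2)[OF 2(1)] by simp
    then have "(\<forall>a\<in>set ?us. l < a) \<longleftrightarrow> (\<forall>a\<in>set ?ts. l < a)" by (simp only:)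
    then have "(\<forall>t\<in>set us. l < label t) \<longleftrightarrow> (\<forall>t\<in>set ts. l < label t)"
      by simp
    moreover have "(\<forall>t\<in>set us. increasing t) \<longleftrightarrow> (\<forall>t\<in>set ts. increasing t)"
      using "1.IH"[OF 2(1)] "1.prems"(2) by simp
    ultimately show ?thesis unfolding 2 increasing.simps ball_conj_distrib by (simp only:)
  qed
next
  case (3 x t ts)
  from "3.prems"(1) consider u where "(v, u) \<in> set (grow x t)" "ts' = u # ts"
    | us where "(v, us) \<in> set (grow_forest x ts)" "ts' = t # us"
    by auto
  then show ?case
  proof cases
    case 1
    then show ?thesis using "3.IH"(1)[OF 1(1)] "3.prems"(2) by simp
  next
    case 2
    then show ?thesis using "3.IH"(2)[OF 2(1)] "3.prems"(2) by simp
  qed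
qed auto

text \<open>
  The position of the fresh label tells how the leaf was inserted. Thus sums over this list are sums
  over the set of grown trees.
\<close>

lemma distinct_grow:
  shows "x \<notin> set (labels T) \<Longrightarrow> distinct (map snd (grow x T))"
    and "x \<notin> set (concat (map labels ts)) \<Longrightarrow> distinct (map snd (grow_forest x ts))"
proof (induction x T and x ts rule: grow_grow_forest.induct)
  case (1 x l ts)
  let ?A = "insertions (Node x []) ts" and ?B = "map snd (grow_forest x ts)"
  have "length us = length ts" if "us \<in> set ?B" for us
    using that grow_structure(2)[of _ us x ts] by (metis (no_types, lifting) imageE length_map list.set_map prod.collapse)
  moreover have "length us = Suc (length ts)" if "us \<in> set ?A" for us
    using mset_insertions[OF that] by (metis size_add_mset size_mset)
  ultimately have "set ?A \<inter> set ?B = {}" by fastforce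
  moreover have "distinct ?A" using "1.prems" by (intro distinct_insertions) force
  moreover have "distinct ?B" by (rule "1.IH") (use "1.prems" in simp)
  ultimately have "distinct (?A @ ?B)" by (simp only: distinct_append)
  then have "distinct (map (Node l) (?A @ ?B))" by (subst distinct_map) (simp add: inj_on_def)
  moreover have "map snd (grow x (Node l ts)) = map (Node l) (?A @ ?B)" by auto
  ultimately show ?case by (simp only:)
next
  case (3 x t ts)
  have a: "map snd (map (\<lambda>(v, u). (v, u # ts)) (grow x t)) = map (\<lambda>u. u # ts) (map snd (grow x t))"
    "map snd (map (\<lambda>(v, us). (v, t # us)) (grow_forest x ts)) = map ((#) t) (map snd (grow_forest x ts))"
    by auto
  have "t \<noteq> u" if "(v, u) \<in> set (grow x t)" for v u
  proof -
    have "mset (labels u) = add_mset x (mset (labels t))" using grow_structure(1)[OF that] by simp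
    then have "x \<in> set (labels u)" by (metis set_mset_mset union_single_eq_member)
    then show ?thesis using 3 by auto
  qed
  then have "set (map (\<lambda>u. u # ts) (map snd (grow x t))) \<inter> set (map ((#) t) (map snd (grow_forest x ts))) = {}"
    by force
  moreover have "distinct (map snd (grow x t))" "distinct (map snd (grow_forest x ts))"
    using 3 by auto
  ultimately show ?case
    unfolding grow_forest.simps map_append a distinct_append
    by (simp only: distinct_map[of _ "map snd _"] inj_on_def list.inject simp_thms) blast
qed auto

lemma mem_grow_forest:
  "(v, t') \<in> set (grow x t) \<Longrightarrow> (v, us @ t' # vs) \<in> set (grow_forest x (us @ t # vs))"
  by (induction us) force+

text \<open>
  The node with the largest label of an increasing tree is a leaf, so it can be cut off.
\<close>

lemma grow_surjective:
  assumes "increasing T'" "x \<in> set (labels T')" "x \<noteq> label T'" "\<forall>l\<in>set (labels T'). l \<le> x"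
  shows "\<exists>v T. (v, T') \<in> set (grow x T)"
  using assms
proof (induction T')
  case (Node l ts)
  then obtain t where t: "t \<in> set ts" "x \<in> set (labels t)" by auto
  then obtain us vs where ts: "ts = us @ t # vs" by (meson split_list)
  show ?case
  proof (cases "x = label t")
    case True
    obtain cs where cs: "t = Node x cs" using True by (cases t) auto
    \<comment> \<open>A child of \<open>x\<close> would have a label larger than \<open>x\<close>.\<close>
    have "cs = []"
    proof (rule ccontr)
      assume "cs \<noteq> []"
      then obtain c where c: "c \<in> set cs" by (cases cs) auto
      then have "x < label c" using Node.prems(1) t(1) cs by auto
      moreover have "label c \<in> set (labels (Node l ts))" using c t(1) cs label_in_labels[of c] by fastforce
      ultimately show False using Node.prems(4) by (meson leD)
    qed
    then have "(l, Node l ts) \<in> set (grow x (Node l (us @ vs)))"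
      using mem_insertions[of us t vs] cs ts by auto
    then show ?thesis by blast
  next
    case False
    have "\<exists>v T. (v, t) \<in> set (grow x T)"
      using Node.prems t False by (intro Node.IH) auto
    then obtain v T where "(v, t) \<in> set (grow x T)" by blast
    from mem_grow_forest[OF this, of us vs] have "(v, Node l ts) \<in> set (grow x (Node l (us @ T # vs)))"
      unfolding ts by auto
    then show ?thesis by blast
  qed
qed

text \<open>
  A left inverse of growth; it shows that different trees grow into different trees.
\<close>

fun prune :: "nat \<Rightarrow> plane_tree \<Rightarrow> plane_tree" where
  "prune x (Node l ts) = Node l (map (prune x) (filter (\<lambda>t. label t \<noteq> x) ts))"

lemma prune_fresh: "x \<notin> set (labels T) \<Longrightarrow> prune x T = T"
proof (induction T)
  case (Node l ts)
  have "label t \<noteq> x" if "t \<in> set ts" for t using Node.prems label_in_labels[of t] that by auto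
  then have "filter (\<lambda>t. label t \<noteq> x) ts = ts" by (simp add: filter_id_conv)
  then show ?case using Node by (simp add: map_idI)
qed

lemma prune_grow:
  shows "(v, T') \<in> set (grow x T) \<Longrightarrow> x \<notin> set (labels T) \<Longrightarrow> prune x T' = T"
    and "(v, ts') \<in> set (grow_forest x ts) \<Longrightarrow> x \<notin> set (concat (map labels ts)) \<Longrightarrow>
      map (prune x) (filter (\<lambda>t. label t \<noteq> x) ts') = ts"
proof (induction x T and x ts arbitrary: v T' and v ts' rule: grow_grow_forest.induct)
  case (1 x l ts)
  from "1.prems"(1) consider us where "us \<in> set (insertions (Node x []) ts)" "v = l" "T' = Node l us"
    | us where "(v, us) \<in> set (grow_forest x ts)" "T' = Node l us"
    by auto
  then show ?case
  proof cases
    case 1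
    have "filter (\<lambda>t. label t \<noteq> x) us = filter (\<lambda>t. label t \<noteq> x) ts"
      using 1(1) by (induction ts arbitrary: us) auto
    then have "prune x T' = prune x (Node l ts)" using 1 by simp
    then show ?thesis using prune_fresh "1.prems"(2) by metis
  next
    case 2
    then show ?thesis using "1.IH"[OF 2(1)] "1.prems"(2) by simp
  qed
next
  case (3 x t ts)
  have fresh: "x \<noteq> label t" "x \<notin> set (labels t)" "x \<notin> set (concat (map labels ts))"
    using "3.prems"(2) label_in_labels[of t] by auto
  have ts: "map (prune x) (filter (\<lambda>t. label t \<noteq> x) ts) = ts"
    using prune_fresh[of x "Node (Suc x) ts"] fresh(3) by auto
  from "3.prems"(1) consider u where "(v, u) \<in> set (grow x t)" "ts' = u # ts"
    | us where "(v, us) \<in> set (grow_forest x ts)" "ts' = t # us"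
    by auto
  then show ?case
  proof cases
    case 1
    then show ?thesis using "3.IH"(1)[OF 1(1)] grow_structure(1)[OF 1(1)] fresh ts by simp
  next
    case 2
    then show ?thesis using "3.IH"(2)[OF 2(1)] fresh by (simp add: prune_fresh)
  qed
qed auto

fun degrees :: "plane_tree \<Rightarrow> (nat \<times> nat) list" where
  "degrees (Node l ts) = (l, length ts) # concat (map degrees ts)"

lemma map_fst_degrees: "map fst (degrees T) = labels T"
  by (induction T) (simp add: map_concat cong: map_cong)

lemma edges_labels: "edges T \<subseteq> set (labels T) \<times> set (labels T)"
proof (induction T)
  case (Node l ts)
  then show ?case using label_in_labels by fastforce
qed

lemma distinct_label_forest: "distinct (concat (map labels ts)) \<Longrightarrow> distinct (map label ts)"
proof (induction ts)
  case (Cons t ts)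
  have "label t \<noteq> label s" if "s \<in> set ts" for s
    using Cons.prems that label_in_labels[of t] label_in_labels[of s] by auto
  then show ?case using Cons by auto
qed simp

text \<open>
  With distinct labels the edge relation still knows all outdegrees, although it forgets the order of
  the children.
\<close>

lemma card_edges_degrees:
  assumes "distinct (labels T)" "(v, d) \<in> set (degrees T)"
  shows "card (edges T `` {v}) = d"
  using assms
proof (induction T)
  case (Node l ts)
  note el = edges_labels[THEN subsetD]
  have dis: "distinct (concat (map labels ts))" and l: "l \<notin> set (concat (map labels ts))"
    using Node.prems(1) by auto
  show ?case
  proof (cases "v = l")
    case True
    have "(v, d) \<notin> set (concat (map degrees ts))"
    proof
      assume "(v, d) \<in> set (concat (map degrees ts))"
      then obtain t where "t \<in> set ts" "(v, d) \<in> set (degrees t)" by auto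
      then have "v \<in> set (labels t)" by (metis fst_conv image_eqI list.set_map map_fst_degrees)
      then show False using \<open>t \<in> set ts\<close> l True by auto
    qed
    then have d: "d = length ts" using Node.prems(2) by auto
    have "edges (Node l ts) `` {v} = label ` set ts" using True l el by fastforce
    then have "card (edges (Node l ts) `` {v}) = card (set (map label ts))" by simp
    also have "\<dots> = d" using distinct_card[OF distinct_label_forest[OF dis]] d by simp
    finally show ?thesis .
  next
    case False
    then obtain t where t: "t \<in> set ts" "(v, d) \<in> set (degrees t)" using Node.prems(2) by auto
    then have v: "v \<in> set (labels t)" by (metis fst_conv image_eqI list.set_map map_fst_degrees)
    obtain us vs where ts: "ts = us @ t # vs" using t(1) by (meson split_list)
    have "v \<notin> set (labels s)" if "s \<in> set (us @ vs)" for s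
      using dis v that unfolding ts by auto
    then have "edges s `` {v} = {}" if "s \<in> set (us @ vs)" for s using that el by fastforce
    then have "edges (Node l ts) `` {v} = edges t `` {v}" using False unfolding ts by auto
    moreover have "distinct (labels t)" using dis unfolding ts by auto
    ultimately show ?thesis using Node.IH[OF t(1)] t(2) by simp
  qed
qed

section \<open>Weights of grown trees\<close>

text \<open>
  A leaf under a node of outdegree \<open>d\<close> can take \<open>d + 1\<close> positions, and each of them replaces the factor
  \<open>\<phi>\<^sub>d\<close> of the weight by \<open>\<phi>\<^sub>d\<^sub>+\<^sub>1 * \<phi>\<^sub>0\<close>. The factor \<open>q d\<close> stands for \<open>(d + 1) * \<phi>\<^sub>d\<^sub>+\<^sub>1 * \<phi>\<^sub>0 / \<phi>\<^sub>d\<close>, but is introduced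
  by a product, because the coefficients vanish beyond a maximal outdegree if \<open>c2 > 0\<close>.
\<close>

lemma sum_grow_weight:
  fixes \<phi> :: "real fps"
  assumes "\<And>k. real (Suc k) * fps_nth \<phi> (Suc k) * fps_nth \<phi> 0 = q k * fps_nth \<phi> k"
  shows "(\<Sum>(v, T')\<leftarrow>grow x T. weight \<phi> T' * g v) = weight \<phi> T * (\<Sum>(v, d)\<leftarrow>degrees T. q d * g v)"
    and "(\<Sum>(v, ts')\<leftarrow>grow_forest x ts. prod_list (map (weight \<phi>) ts') * g v) =
      prod_list (map (weight \<phi>) ts) * (\<Sum>(v, d)\<leftarrow>concat (map degrees ts). q d * g v)"
proof (induction x T and x ts rule: grow_grow_forest.induct)
  case (1 x l ts)
  let ?P = "prod_list (map (weight \<phi>) ts)"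
  have w: "weight \<phi> (Node l us) * g l = fps_nth \<phi> (Suc (length ts)) * fps_nth \<phi> 0 * ?P * g l"
    if "us \<in> set (insertions (Node x []) ts)" for us
  proof -
    have m: "mset us = add_mset (Node x []) (mset ts)" by (rule mset_insertions[OF that])
    then have "length us = Suc (length ts)" by (metis size_add_mset size_mset)
    moreover have "prod_mset (image_mset (weight \<phi>) (mset us)) = fps_nth \<phi> 0 * ?P"
      unfolding m by (simp add: prod_mset_prod_list flip: mset_map)
    then have "prod_list (map (weight \<phi>) us) = fps_nth \<phi> 0 * ?P"
      by (simp add: prod_mset_prod_list flip: mset_map)
    ultimately show ?thesis by simp
  qed
  have "(\<Sum>us\<leftarrow>insertions (Node x []) ts. weight \<phi> (Node l us) * g l) =
      (\<Sum>us\<leftarrow>insertions (Node x []) ts. fps_nth \<phi> (Suc (length ts)) * fps_nth \<phi> 0 * ?P * g l)"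
    using w by (intro arg_cong[of _ _ sum_list] map_cong) auto
  also have "\<dots> = real (Suc (length ts)) * fps_nth \<phi> (Suc (length ts)) * fps_nth \<phi> 0 * ?P * g l"
    by (simp add: sum_list_triv length_insertions)
  also have "\<dots> = weight \<phi> (Node l ts) * (q (length ts) * g l)" unfolding assms by simp
  finally have root: "(\<Sum>us\<leftarrow>insertions (Node x []) ts. weight \<phi> (Node l us) * g l) =
      weight \<phi> (Node l ts) * (q (length ts) * g l)" .
  have "length us = length ts" if "(v, us) \<in> set (grow_forest x ts)" for v us
    using grow_structure(2)[OF that] by (metis length_map)
  then have "(\<Sum>(v, us)\<leftarrow>grow_forest x ts. weight \<phi> (Node l us) * g v) =
      (\<Sum>(v, us)\<leftarrow>grow_forest x ts. fps_nth \<phi> (length ts) * (prod_list (map (weight \<phi>) us) * g v))"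
    by (intro arg_cong[of _ _ sum_list] map_cong) auto
  also have "\<dots> = fps_nth \<phi> (length ts) * (\<Sum>(v, us)\<leftarrow>grow_forest x ts. prod_list (map (weight \<phi>) us) * g v)"
    by (simp add: sum_list_const_mult case_prod_unfold)
  also have "\<dots> = weight \<phi> (Node l ts) * (\<Sum>(v, d)\<leftarrow>concat (map degrees ts). q d * g v)"
    unfolding "1.IH" by simp
  finally show ?case
    using root by (simp add: case_prod_unfold comp_def distrib_left del: weight.simps)
next
  case (3 x t ts)
  have "(\<Sum>(v, us)\<leftarrow>grow_forest x (t # ts). prod_list (map (weight \<phi>) us) * g v) =
      (\<Sum>(v, u)\<leftarrow>grow x t. weight \<phi> u * g v) * prod_list (map (weight \<phi>) ts) +
      weight \<phi> t * (\<Sum>(v, us)\<leftarrow>grow_forest x ts. prod_list (map (weight \<phi>) us) * g v)"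
    by (simp add: case_prod_unfold mult_ac comp_def
          flip: sum_list_const_mult sum_list_mult_const)
  then show ?case unfolding "3.IH" by (simp add: algebra_simps)
qed simp

lemma increasing_trees_grow:
  assumes "T \<in> increasing_trees n" "n \<ge> 1" "(v, T') \<in> set (grow (Suc n) T)"
  shows "T' \<in> increasing_trees (Suc n)" "edges T' = insert (v, Suc n) (edges T)" "v \<in> {1..n}"
proof -
  have T: "increasing T" "distinct (labels T)" "set (labels T) = {1..n}"
    using assms(1) by (auto simp: increasing_trees_def)
  note s = grow_structure(1)[OF assms(3)]
  have m: "mset (labels T') = mset (Suc n # labels T)" using s by simp
  have "distinct (labels T')" using mset_eq_imp_distinct_iff[OF m] T by simp
  moreover have "set (labels T') = set (Suc n # labels T)" by (rule mset_eq_setD[OF m])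
  moreover have "set (Suc n # labels T) = {1..Suc n}" using T(3) atLeastAtMostSuc_conv[of 1 n] by simp
  moreover have "increasing T'" using grow_increasing(1)[OF assms(3)] T by auto
  ultimately show "T' \<in> increasing_trees (Suc n)" by (simp add: increasing_trees_def)
  show "edges T' = insert (v, Suc n) (edges T)" "v \<in> {1..n}" using s T(3) by auto
qed

lemma increasing_trees_Suc:
  assumes "T' \<in> increasing_trees (Suc n)" "n \<ge> 1"
  shows "\<exists>v. \<exists>T\<in>increasing_trees n. (v, T') \<in> set (grow (Suc n) T)"
proof -
  have T': "increasing T'" "distinct (labels T')" "set (labels T') = {1..Suc n}"
    using assms(1) by (auto simp: increasing_trees_def)
  have "label T' \<le> 1" using label_least[OF T'(1), of 1] T'(3) by simp
  then obtain v T where vT: "(v, T') \<in> set (grow (Suc n) T)"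
    using grow_surjective[OF T'(1), of "Suc n"] T'(3) assms(2) by force
  have m: "mset (labels T') = mset (Suc n # labels T)" using grow_structure(1)[OF vT] by simp
  have d: "distinct (Suc n # labels T)" using T'(2) mset_eq_imp_distinct_iff[OF m] by simp
  have "set (Suc n # labels T) = {1..Suc n}" using mset_eq_setD[OF m] T'(3) by simp
  then have "insert (Suc n) (set (labels T)) = insert (Suc n) {1..n}"
    using atLeastAtMostSuc_conv[of 1 n] by simp
  moreover have "Suc n \<notin> set (labels T)" "Suc n \<notin> {1..n}" using d by auto
  ultimately have s: "set (labels T) = {1..n}" by (metis insert_ident)
  have "increasing T" using grow_increasing(1)[OF vT] T'(1) s by auto
  then show ?thesis using vT d s by (auto simp: increasing_trees_def)
qed

definition edge_sum :: "real fps \<Rightarrow> nat \<Rightarrow> ((nat \<times> nat) set \<Rightarrow> real) \<Rightarrow> real" where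
  "edge_sum \<phi> n F = (\<Sum>T\<in>increasing_trees n. weight \<phi> T * F (edges T))"

text \<open>
  Every tree of size \<open>n + 1\<close> grows out of exactly one tree of size \<open>n\<close>, which pruning recovers. From
  here on plane trees enter only through their edges.
\<close>

lemma edge_sum_Suc:
  fixes \<phi> :: "real fps"
  assumes step: "\<And>k. real (Suc k) * fps_nth \<phi> (Suc k) * fps_nth \<phi> 0 = q k * fps_nth \<phi> k"
    and "n \<ge> 1"
  shows "edge_sum \<phi> (Suc n) F =
    edge_sum \<phi> n (\<lambda>E. \<Sum>v = 1..n. q (card (E `` {v})) * F (insert (v, Suc n) E))"
proof -
  let ?x = "Suc n" and ?I = "increasing_trees"
  let ?G = "\<lambda>T. set (map snd (grow ?x T))"
  have fresh: "?x \<notin> set (labels T)" if "T \<in> ?I n" for T using that by (simp add: increasing_trees_def)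
  have "?I ?x = (\<Union>T\<in>?I n. ?G T)"
  proof (intro equalityI subsetI)
    fix T' assume "T' \<in> ?I ?x"
    from increasing_trees_Suc[OF this assms(2)] obtain v T where
      T: "T \<in> ?I n" "(v, T') \<in> set (grow ?x T)" by blast
    then have "T' \<in> ?G T" by (metis image_eqI list.set_map snd_conv)
    with T(1) show "T' \<in> (\<Union>T\<in>?I n. ?G T)" by blast
  next
    fix T' assume "T' \<in> (\<Union>T\<in>?I n. ?G T)"
    then obtain v T where T: "T \<in> ?I n" "(v, T') \<in> set (grow ?x T)" by auto
    show "T' \<in> ?I ?x" by (rule increasing_trees_grow(1)[OF T(1) assms(2) T(2)])
  qed
  then have "edge_sum \<phi> ?x F = (\<Sum>T'\<in>(\<Union>T\<in>?I n. ?G T). weight \<phi> T' * F (edges T'))"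
    by (simp add: edge_sum_def)
  also have "\<dots> = (\<Sum>T\<in>?I n. \<Sum>T'\<in>?G T. weight \<phi> T' * F (edges T'))"
  proof (rule sum.UNION_disjoint)
    have p: "prune ?x T' = T" if "T \<in> ?I n" "T' \<in> ?G T" for T T'
      using that(2) prune_grow(1)[OF _ fresh[OF that(1)]] by auto
    show "\<forall>T\<in>?I n. \<forall>U\<in>?I n. T \<noteq> U \<longrightarrow> ?G T \<inter> ?G U = {}"
      using p by (metis disjoint_iff)
  qed (simp_all add: finite_increasing_trees)
  also have "\<dots> = (\<Sum>T\<in>?I n. weight \<phi> T *
      (\<Sum>v = 1..n. q (card (edges T `` {v})) * F (insert (v, ?x) (edges T))))"
  proof (rule sum.cong)
    fix T assume T: "T \<in> ?I n"
    let ?g = "\<lambda>v. F (insert (v, ?x) (edges T))"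
    have dl: "distinct (labels T)" "set (labels T) = {1..n}" using T by (auto simp: increasing_trees_def)
    have "(\<Sum>T'\<in>?G T. weight \<phi> T' * F (edges T')) =
        (\<Sum>T'\<leftarrow>map snd (grow ?x T). weight \<phi> T' * F (edges T'))"
      by (rule sum_list_distinct_conv_sum_set[symmetric]) (rule distinct_grow(1)[OF fresh[OF T]])
    also have "\<dots> = (\<Sum>(v, T')\<leftarrow>grow ?x T. weight \<phi> T' * ?g v)"
      unfolding map_map
      using increasing_trees_grow(2)[OF T assms(2)] by (intro arg_cong[of _ _ sum_list] map_cong) auto
    also have "\<dots> = weight \<phi> T * (\<Sum>(v, d)\<leftarrow>degrees T. q d * ?g v)"
      by (rule sum_grow_weight(1)[OF step])
    also have "(\<Sum>(v, d)\<leftarrow>degrees T. q d * ?g v) =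
        (\<Sum>v\<leftarrow>map fst (degrees T). q (card (edges T `` {v})) * ?g v)"
      unfolding map_map
      using card_edges_degrees[OF dl(1)] by (intro arg_cong[of _ _ sum_list] map_cong) auto
    also have "\<dots> = (\<Sum>v = 1..n. q (card (edges T `` {v})) * ?g v)"
      unfolding map_fst_degrees by (subst sum_list_distinct_conv_sum_set[OF dl(1)]) (simp only: dl(2))
    finally show "(\<Sum>T'\<in>?G T. weight \<phi> T' * F (edges T')) =
        weight \<phi> T * (\<Sum>v = 1..n. q (card (edges T `` {v})) * ?g v)" .
  qed simp
  finally show ?thesis by (simp add: edge_sum_def)
qed

lemma increasing_trees_1: "increasing_trees 1 = {Node 1 []}"
proof -
  have "T = Node 1 []" if "T \<in> increasing_trees 1" for T
  proof (cases T)
    case (Node l ts)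
    define ls where "ls = concat (map labels ts)"
    have T: "distinct (l # ls)" "set (l # ls) = {1}"
      using that Node by (auto simp: increasing_trees_def ls_def)
    then have "l = 1" "ls = []" by (cases ls; auto)+
    then have "ts = []" using label_in_labels[of "hd ts"] by (cases ts) (auto simp: ls_def)
    then show ?thesis using \<open>l = 1\<close> Node by simp
  qed
  moreover have "Node 1 [] \<in> increasing_trees 1" by (simp add: increasing_trees_def)
  ultimately show ?thesis by blast
qed

text \<open>
  The edge sets of increasing trees.
\<close>

inductive recursive_tree :: "nat \<Rightarrow> (nat \<times> nat) set \<Rightarrow> bool" where
  single: "recursive_tree 1 {}"
| attach: "recursive_tree n E \<Longrightarrow> v \<in> {1..n} \<Longrightarrow> recursive_tree (Suc n) (insert (v, Suc n) E)"

lemma recursive_tree_edges: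
  assumes "T \<in> increasing_trees n" "n \<ge> 1"
  shows "recursive_tree n (edges T)"
  using assms(2,1)
proof (induction n arbitrary: T rule: dec_induct)
  case base
  then show ?case using recursive_tree.single by (simp add: increasing_trees_1[simplified])
next
  case (step n)
  from increasing_trees_Suc[OF step.prems step.hyps(1)] obtain v T0
    where T0: "T0 \<in> increasing_trees n" "(v, T) \<in> set (grow (Suc n) T0)" by blast
  then show ?case
    using increasing_trees_grow[OF T0(1) step.hyps(1) T0(2)] step.IH[OF T0(1)] by (simp add: attach)
qed

section \<open>Recursive trees and their growth\<close>

lemma recursive_tree_edge:
  assumes "recursive_tree n E" "(i, j) \<in> E"
  shows "1 \<le> i" "i < j" "j \<le> n"
proof -
  have "1 \<le> i \<and> i < j \<and> j \<le> n" using assms by induction auto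
  then show "1 \<le> i" "i < j" "j \<le> n" by auto
qed

lemma recursive_tree_size_pos: "recursive_tree n E \<Longrightarrow> 1 \<le> n"
  by (induction rule: recursive_tree.induct) auto

lemma finite_recursive_tree: "recursive_tree n E \<Longrightarrow> finite E"
  by (induction rule: recursive_tree.induct) auto

lemma recursive_tree_parent:
  assumes "recursive_tree n E" "2 \<le> j" "j \<le> n"
  obtains i where "(i, j) \<in> E"
proof -
  have "\<exists>i. (i, j) \<in> E" using assms
  proof induction
    case (attach n E v)
    then show ?case by (cases "j = Suc n") auto
  qed auto
  then show ?thesis using that by blast
qed

lemma recursive_tree_parent_unique:
  assumes "recursive_tree n E" shows "(i, j) \<in> E \<Longrightarrow> (i', j) \<in> E \<Longrightarrow> i = i'"
  using assms
proof (induction)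
  case (attach n E v)
  then show ?case using recursive_tree_edge(3)[OF attach.hyps(1), of _ "Suc n"] by auto
qed auto

lemma recursive_tree_reach_le:
  assumes "recursive_tree n E" "(i, j) \<in> E\<^sup>*" shows "i \<le> j"
  using assms(2)
proof induction
  case (step y z)
  then show ?case using recursive_tree_edge(2)[OF assms(1) step.hyps(2)] by simp
qed simp

definition descendants :: "(nat \<times> nat) set \<Rightarrow> nat \<Rightarrow> nat set" where
  "descendants E k = E\<^sup>* `` {k}"

lemma descendants_self: "k \<in> descendants E k"
  by (simp add: descendants_def)

lemma descendants_subset:
  assumes "recursive_tree n E" "k \<in> {1..n}" shows "descendants E k \<subseteq> {1..n}"
proof
  fix w assume "w \<in> descendants E k"
  then have "(k, w) \<in> E\<^sup>*" by (simp add: descendants_def)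
  then show "w \<in> {1..n}" using assms(2)
  proof induction
    case (step y z)
    then show ?case using recursive_tree_edge[OF assms(1) step.hyps(2)] by auto
  qed
qed

lemma finite_descendants: "recursive_tree n E \<Longrightarrow> k \<in> {1..n} \<Longrightarrow> finite (descendants E k)"
  by (erule finite_subset[OF descendants_subset finite_atLeastAtMost])

lemma reach_new_node:
  assumes "recursive_tree n E" "(Suc n, y) \<in> E\<^sup>*" shows "y = Suc n"
  using assms(2)
proof (cases rule: converse_rtranclE)
  case (step z)
  then show ?thesis using recursive_tree_edge(2,3)[OF assms(1) step(1)] by simp
qed simp

lemma descendants_attach:
  assumes "recursive_tree n E" "k \<noteq> Suc n"
  shows "descendants (insert (v, Suc n) E) k = (if v \<in> descendants E k then insert (Suc n) (descendants E k) else descendants E k)"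
  using reach_new_node[OF assms(1)] by (auto simp: descendants_def rtrancl_insert)

lemma descendants_attach_new:
  assumes "recursive_tree n E" "v \<in> {1..n}"
  shows "descendants (insert (v, Suc n) E) (Suc n) = {Suc n}"
  using reach_new_node[OF assms(1)] assms(2) by (auto simp: descendants_def rtrancl_insert)

lemma children_attach:
  "insert (v, x) E `` {k} = (if v = k then insert x (E `` {k}) else E `` {k})"
  by auto

lemma new_node_no_edges:
  assumes "recursive_tree n E" shows "E `` {Suc n} = {}" "Suc n \<notin> E `` {k}"
  using recursive_tree_edge(2,3)[OF assms] by force+

lemma finite_children: "recursive_tree n E \<Longrightarrow> finite (E `` {k})"
  by (simp add: finite_recursive_tree finite_Image)

text \<open>
  Apart from \<open>k\<close> itself, each descendant of \<open>k\<close> is the child of exactly one descendant.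
\<close>

lemma sum_outdegree_descendants:
  assumes "recursive_tree n E" "k \<in> {1..n}"
  shows "(\<Sum>v\<in>descendants E k. card (E `` {v})) + 1 = card (descendants E k)"
  using assms
proof (induction)
  case single
  then show ?case by (auto simp: descendants_def)
next
  case (attach n E v)
  let ?x = "Suc n" and ?E = "insert (v, Suc n) E"
  show ?case
  proof (cases "k = ?x")
    case True
    have "?E `` {?x} = {}" using new_node_no_edges(1)[OF attach.hyps(1)] attach.hyps(2)
      by (simp add: children_attach)
    then show ?thesis unfolding True descendants_attach_new[OF attach.hyps] by simp
  next
    case False
    then have k: "k \<in> {1..n}" using attach.prems by auto
    note IH = attach.IH[OF k] and fin = finite_descendants[OF attach.hyps(1) k]
    have x: "?x \<notin> descendants E k" using descendants_subset[OF attach.hyps(1) k] by auto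
    have c: "card (?E `` {u}) = card (E `` {u}) + of_bool (v = u)" for u
      using new_node_no_edges(2)[OF attach.hyps(1)] finite_children[OF attach.hyps(1)]
      by (simp add: children_attach)
    have cx: "card (?E `` {?x}) = 0"
      using new_node_no_edges(1)[OF attach.hyps(1)] attach.hyps(2) by (simp add: children_attach)
    have "(\<Sum>u\<in>descendants E k. card (?E `` {u})) = (\<Sum>u\<in>descendants E k. card (E `` {u})) + of_bool (v \<in> descendants E k)"
      unfolding c sum.distrib using fin by (simp add: of_bool_def)
    then show ?thesis
      using IH x fin cx unfolding descendants_attach[OF attach.hyps(1) False] by simp
  qed
qed

lemma root_descendants:
  assumes "recursive_tree n E" shows "descendants E 1 = {1..n}"
proof -
  have "(1, j) \<in> E\<^sup>*" if "j \<in> {1..n}" for j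
    using that
  proof (induction j rule: less_induct)
    case (less j)
    show ?case
    proof (cases "j = 1")
      case False
      then obtain i where i: "(i, j) \<in> E" using recursive_tree_parent[OF assms, of j] less.prems by auto
      then have "(1, i) \<in> E\<^sup>*"
        using less recursive_tree_edge[OF assms i] by auto
      then show ?thesis using i by simp
    qed simp
  qed
  then show ?thesis using descendants_subset[OF assms, of 1] recursive_tree_size_pos[OF assms]
    by (auto simp: descendants_def)
qed

text \<open>
  The chance of a node to become the parent of the next node depends on its outdegree, but for a whole
  subtree the chances add up to a function of its size. This makes subtree sizes Markovian.
\<close>

lemma attraction_descendants:
  fixes \<alpha> :: real
  assumes "recursive_tree n E" "k \<in> {1..n}"
  shows "(\<Sum>v\<in>descendants E k. \<alpha> - (\<alpha> - 1) * card (E `` {v})) = card (descendants E k) + \<alpha> - 1"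
proof -
  have "(\<Sum>v\<in>descendants E k. \<alpha> - (\<alpha> - 1) * card (E `` {v})) =
      card (descendants E k) * \<alpha> - (\<alpha> - 1) * real (\<Sum>v\<in>descendants E k. card (E `` {v}))"
    by (simp add: sum_subtractf sum_distrib_left)
  also have "real (\<Sum>v\<in>descendants E k. card (E `` {v})) = real (card (descendants E k)) - 1"
    using sum_outdegree_descendants[OF assms] by linarith
  finally show ?thesis by (simp add: algebra_simps)
qed

lemma attraction_total:
  fixes \<alpha> :: real
  assumes "recursive_tree n E"
  shows "(\<Sum>v = 1..n. \<alpha> - (\<alpha> - 1) * card (E `` {v})) = n + \<alpha> - 1"
  using attraction_descendants[OF assms, of 1 \<alpha>] recursive_tree_size_pos[OF assms] root_descendants[OF assms] by simp

text \<open>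
  The next node falls outside or inside the subtree at \<open>k\<close>, with chances proportional to
  \<open>n - S k\<close> and \<open>S k + \<alpha> - 1\<close>.
\<close>

lemma growth_subtree:
  fixes \<alpha> :: real and h :: "nat \<Rightarrow> real"
  assumes "recursive_tree n E" "k \<in> {1..n}"
  shows "(\<Sum>v = 1..n. (\<alpha> - (\<alpha> - 1) * card (E `` {v})) * h (card (descendants (insert (v, Suc n) E) k))) =
    (real n - card (descendants E k)) * h (card (descendants E k)) +
    (card (descendants E k) + \<alpha> - 1) * h (Suc (card (descendants E k)))"
proof -
  let ?q = "\<lambda>v. \<alpha> - (\<alpha> - 1) * card (E `` {v})" and ?D = "descendants E k"
  have sub: "?D \<subseteq> {1..n}" by (rule descendants_subset[OF assms])
  have x: "Suc n \<notin> ?D" using sub by auto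
  have cd: "card (descendants (insert (v, Suc n) E) k) = (if v \<in> ?D then Suc (card ?D) else card ?D)" for v
    using descendants_attach[OF assms(1), of k v] assms(2) x finite_descendants[OF assms] by auto
  have "(\<Sum>v = 1..n. ?q v * h (card (descendants (insert (v, Suc n) E) k))) =
      (\<Sum>v\<in>{1..n} - ?D. ?q v * h (card ?D)) + (\<Sum>v\<in>?D. ?q v * h (Suc (card ?D)))"
    unfolding cd
    by (subst sum.subset_diff[OF sub finite_atLeastAtMost]) (intro arg_cong2[where f = "(+)"] sum.cong, auto)
  also have "\<dots> = (sum ?q {1..n} - sum ?q ?D) * h (card ?D) + sum ?q ?D * h (Suc (card ?D))"
    unfolding sum_distrib_right[symmetric] using sum_diff[OF finite_atLeastAtMost sub, of ?q] by (simp only:)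
  finally show ?thesis
    unfolding attraction_total[OF assms(1)] attraction_descendants[OF assms] by (simp add: algebra_simps)
qed

text \<open>
  The old children of \<open>k\<close> are treated by the previous lemma. The last term is the new node as a child of
  \<open>k\<close>; it starts with a subtree of size one.
\<close>

lemma growth_children:
  fixes \<alpha> :: real and h :: "nat \<Rightarrow> real"
  assumes "recursive_tree n E" "k \<in> {1..n}"
  shows "(\<Sum>v = 1..n. (\<alpha> - (\<alpha> - 1) * card (E `` {v})) *
      (\<Sum>j\<in>insert (v, Suc n) E `` {k}. h (card (descendants (insert (v, Suc n) E) j)))) =
    (\<Sum>j\<in>E `` {k}. (real n - card (descendants E j)) * h (card (descendants E j)) +
      (card (descendants E j) + \<alpha> - 1) * h (Suc (card (descendants E j)))) +
    (\<alpha> - (\<alpha> - 1) * card (E `` {k})) * h 1"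
proof -
  let ?q = "\<lambda>v. \<alpha> - (\<alpha> - 1) * card (E `` {v})" and ?E = "\<lambda>v. insert (v, Suc n) E"
  have ch: "(\<Sum>j\<in>?E v `` {k}. h (card (descendants (?E v) j))) =
      (\<Sum>j\<in>E `` {k}. h (card (descendants (?E v) j))) + of_bool (v = k) * h 1" if "v \<in> {1..n}" for v
    using new_node_no_edges(2)[OF assms(1), of k] finite_children[OF assms(1), of k]
      descendants_attach_new[OF assms(1) that] by (cases "v = k") (simp_all add: children_attach)
  have "(\<Sum>v = 1..n. ?q v * (\<Sum>j\<in>?E v `` {k}. h (card (descendants (?E v) j)))) =
      (\<Sum>v = 1..n. (\<Sum>j\<in>E `` {k}. ?q v * h (card (descendants (?E v) j))) + of_bool (v = k) * (?q v * h 1))"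
    by (intro sum.cong refl) (simp only: ch distrib_left sum_distrib_left mult_ac)
  also have "\<dots> = (\<Sum>j\<in>E `` {k}. \<Sum>v = 1..n. ?q v * h (card (descendants (?E v) j))) +
      (\<Sum>v = 1..n. of_bool (v = k) * (?q v * h 1))"
    unfolding sum.distrib by (subst sum.swap) simp
  also have "(\<Sum>v = 1..n. of_bool (v = k) * (?q v * h 1)) = ?q k * h 1"
    using assms(2) by (simp add: of_bool_def if_distrib[of "\<lambda>a. a * _"] cong: if_cong)
  also have "(\<Sum>j\<in>E `` {k}. \<Sum>v = 1..n. ?q v * h (card (descendants (?E v) j))) =
    (\<Sum>j\<in>E `` {k}. (real n - card (descendants E j)) * h (card (descendants E j)) +
      (card (descendants E j) + \<alpha> - 1) * h (Suc (card (descendants E j))))"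
  proof (rule sum.cong)
    fix j assume "j \<in> E `` {k}"
    then have "j \<in> {1..n}" using recursive_tree_edge[OF assms(1), of k j] by auto
    then show "(\<Sum>v = 1..n. ?q v * h (card (descendants (?E v) j))) =
      (real n - card (descendants E j)) * h (card (descendants E j)) +
      (card (descendants E j) + \<alpha> - 1) * h (Suc (card (descendants E j)))"
      by (rule growth_subtree[OF assms(1)])
  qed simp
  finally show ?thesis .
qed

text \<open>
  The attraction of \<open>k\<close> drops by \<open>\<alpha> - 1\<close> whenever \<open>k\<close> gets a child, which happens with a chance
  proportional to this attraction.
\<close>

lemma growth_outdegree:
  fixes \<alpha> :: real
  assumes "recursive_tree n E" "k \<in> {1..n}"
  shows "(\<Sum>v = 1..n. (\<alpha> - (\<alpha> - 1) * card (E `` {v})) *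
      (\<alpha> - (\<alpha> - 1) * card (insert (v, Suc n) E `` {k}))) =
    real n * (\<alpha> - (\<alpha> - 1) * card (E `` {k}))"
proof -
  let ?q = "\<lambda>v. \<alpha> - (\<alpha> - 1) * card (E `` {v})"
  have c: "\<alpha> - (\<alpha> - 1) * card (insert (v, Suc n) E `` {k}) = ?q k - (\<alpha> - 1) * of_bool (v = k)" for v
    using new_node_no_edges(2)[OF assms(1)] finite_children[OF assms(1)]
    by (simp add: children_attach algebra_simps)
  have "(\<Sum>v = 1..n. ?q v * (\<alpha> - (\<alpha> - 1) * card (insert (v, Suc n) E `` {k}))) =
      (\<Sum>v = 1..n. ?q v * ?q k - of_bool (v = k) * (?q v * (\<alpha> - 1)))"
    unfolding c by (intro sum.cong) (simp_all add: right_diff_distrib mult_ac)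
  also have "\<dots> = (\<Sum>v = 1..n. ?q v) * ?q k - (\<Sum>v = 1..n. of_bool (v = k) * (?q v * (\<alpha> - 1)))"
    unfolding sum_distrib_right by (rule sum_subtractf)
  also have "(\<Sum>v = 1..n. of_bool (v = k) * (?q v * (\<alpha> - 1))) = ?q k * (\<alpha> - 1)"
    using assms(2) by (simp add: of_bool_def if_distrib[of "\<lambda>a. a * _"] cong: if_cong)
  finally show ?thesis unfolding attraction_total[OF assms(1)] by (simp add: algebra_simps)
qed

section \<open>The centroid as the largest heavy node\<close>

definition ancestors :: "(nat \<times> nat) set \<Rightarrow> nat \<Rightarrow> nat set" where
  "ancestors E k = {v. (v, k) \<in> E\<^sup>*}"

lemma mem_ancestors_iff: "v \<in> ancestors E k \<longleftrightarrow> k \<in> descendants E v"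
  by (simp add: ancestors_def descendants_def)

lemma ancestors_self: "k \<in> ancestors E k"
  by (simp add: ancestors_def)

lemma ancestors_le: "recursive_tree n E \<Longrightarrow> v \<in> ancestors E k \<Longrightarrow> v \<le> k"
  using recursive_tree_reach_le by (simp add: ancestors_def)

lemma ancestors_child:
  assumes "recursive_tree n E" "(i, j) \<in> E"
  shows "ancestors E j = insert j (ancestors E i)"
proof (intro equalityI subsetI)
  fix v assume "v \<in> ancestors E j"
  then have "(v, j) \<in> E\<^sup>*" by (simp add: ancestors_def)
  then show "v \<in> insert j (ancestors E i)"
  proof (cases rule: rtranclE)
    case (step z)
    then have "z = i" using recursive_tree_parent_unique[OF assms(1) _ assms(2)] by blast
    then show ?thesis using step by (simp add: ancestors_def)
  qed simp
next
  fix v assume "v \<in> insert j (ancestors E i)"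
  then show "v \<in> ancestors E j"
    using assms(2) by (auto simp: ancestors_def intro: rtrancl_into_rtrancl)
qed

lemma ancestors_subset:
  assumes "recursive_tree n E" "k \<in> {1..n}" shows "ancestors E k \<subseteq> {1..n}"
proof
  fix v assume "v \<in> ancestors E k"
  then have "(v, k) \<in> E\<^sup>*" by (simp add: ancestors_def)
  then show "v \<in> {1..n}"
  proof (cases rule: converse_rtranclE)
    case base
    then show ?thesis using assms(2) by simp
  next
    case (step z)
    then show ?thesis using recursive_tree_edge[OF assms(1) step(1)] by simp
  qed
qed

lemma finite_ancestors: "recursive_tree n E \<Longrightarrow> k \<in> {1..n} \<Longrightarrow> finite (ancestors E k)"
  by (erule finite_subset[OF ancestors_subset finite_atLeastAtMost])

lemma root_ancestors:
  assumes "recursive_tree n E" "k \<in> {1..n}" shows "1 \<in> ancestors E k"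
  using root_descendants[OF assms(1)] assms(2) by (simp add: mem_ancestors_iff)

lemma ancestors_root: assumes "recursive_tree n E" shows "ancestors E 1 = {1}"
proof -
  have n: "1 \<in> {1..n}" using recursive_tree_size_pos[OF assms] by simp
  have "v = 1" if "v \<in> ancestors E 1" for v
    using ancestors_le[OF assms that] ancestors_subset[OF assms n] that by (meson atLeastAtMost_iff le_antisym subsetD)
  then show ?thesis using ancestors_self by blast
qed

lemma ancestors_inj:
  assumes "recursive_tree n E" "ancestors E u = ancestors E w" shows "u = w"
  using ancestors_le[OF assms(1), of u w] ancestors_le[OF assms(1), of w u] ancestors_self[of u E] ancestors_self[of w E] assms(2)
  by simp

text \<open>
  Parents are unique, so the way back from \<open>c\<close> to the root is a chain.
\<close>

lemma ancestors_chain: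
  assumes "recursive_tree n E" "x \<in> ancestors E c" "y \<in> ancestors E c" "x \<le> y"
  shows "x \<in> ancestors E y"
proof -
  have "single_valued (E\<inverse>)"
    using recursive_tree_parent_unique[OF assms(1)] by (auto simp: single_valued_def)
  moreover have "(c, x) \<in> (E\<inverse>)\<^sup>*" "(c, y) \<in> (E\<inverse>)\<^sup>*"
    using assms(2,3) by (simp_all add: ancestors_def rtrancl_converse)
  ultimately have "(x, y) \<in> (E\<inverse>)\<^sup>* \<or> (y, x) \<in> (E\<inverse>)\<^sup>*"
    by (rule single_valued_confluent)
  then have "y \<in> ancestors E x \<or> x \<in> ancestors E y" by (auto simp: ancestors_def rtrancl_converse)
  moreover have "x = y" if "y \<in> ancestors E x" using ancestors_le[OF assms(1) that] assms(4) by simp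
  ultimately show ?thesis using ancestors_self by metis
qed

abbreviation sym_difference :: "nat set \<Rightarrow> nat set \<Rightarrow> nat set" where
  "sym_difference A B \<equiv> (A - B) \<union> (B - A)"

text \<open>
  Passing along an edge changes the set of ancestors by one element. Hence no walk from \<open>u\<close> to \<open>w\<close> is
  shorter than the symmetric difference of their sets of ancestors.
\<close>

lemma card_symdiff_le_walk:
  assumes "recursive_tree n E" "u \<in> {1..n}" "(u, w) \<in> (E \<union> E\<inverse>) ^^ k"
  shows "w \<in> {1..n} \<and> card (sym_difference (ancestors E u) (ancestors E w)) \<le> k"
  using assms(3)
proof (induction k arbitrary: w)
  case 0
  then show ?case using assms(2) by simp
next
  case (Suc k)
  from Suc.prems obtain y where y: "(u, y) \<in> (E \<union> E\<inverse>) ^^ k" "(y, w) \<in> E \<union> E\<inverse>" by auto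
  note IH = Suc.IH[OF y(1)]
  have w: "w \<in> {1..n}" using y(2) recursive_tree_edge[OF assms(1)] by force
  have "ancestors E w = insert w (ancestors E y) \<or> ancestors E y = insert y (ancestors E w)"
    using y(2) ancestors_child[OF assms(1)] by auto
  then obtain z where "sym_difference (ancestors E u) (ancestors E w) \<subseteq> insert z (sym_difference (ancestors E u) (ancestors E y))"
  proof
    assume "ancestors E w = insert w (ancestors E y)"
    then show thesis by (intro that[of w]) auto
  next
    assume "ancestors E y = insert y (ancestors E w)"
    then show thesis by (intro that[of y]) auto
  qed
  moreover have fin: "finite (sym_difference (ancestors E u) (ancestors E y))"
    using finite_ancestors[OF assms(1,2)] finite_ancestors[OF assms(1), of y] IH by simp
  ultimately have "card (sym_difference (ancestors E u) (ancestors E w)) \<le> card (insert z (sym_difference (ancestors E u) (ancestors E y)))"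
    by (intro card_mono) simp_all
  also have "\<dots> \<le> Suc (card (sym_difference (ancestors E u) (ancestors E y)))"
    by (rule card_insert_le_m1) simp_all
  finally show ?case using IH w by simp
qed

text \<open>
  If \<open>u < w\<close>, then \<open>w\<close> is not an ancestor of \<open>u\<close>, so moving from \<open>w\<close> to its parent shrinks the symmetric
  difference by one element. Going up from the larger label repeatedly yields a shortest walk.
\<close>

lemma walk_card_symdiff:
  assumes "recursive_tree n E" "u \<in> {1..n}" "w \<in> {1..n}"
  shows "(u, w) \<in> (E \<union> E\<inverse>) ^^ card (sym_difference (ancestors E u) (ancestors E w))"
  using assms(2,3)
proof (induction "u + w" arbitrary: u w rule: less_induct)
  case less
  let ?R = "E \<union> E\<inverse>"
  have step: "\<exists>i. i \<in> {1..n} \<and> i < y \<and> (i, y) \<in> E \<and>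
      card (sym_difference (ancestors E x) (ancestors E y)) = Suc (card (sym_difference (ancestors E x) (ancestors E i)))"
    if "x \<in> {1..n}" "y \<in> {1..n}" "x < y" for x y
  proof -
    have "2 \<le> y" "y \<le> n" using that by auto
    then obtain i where i: "(i, y) \<in> E" using recursive_tree_parent[OF assms(1)] by blast
    have iy: "i < y" "i \<in> {1..n}" using recursive_tree_edge[OF assms(1) i] by auto
    have "y \<notin> ancestors E x" "y \<notin> ancestors E i" using ancestors_le[OF assms(1), of y] that(3) iy(1) by force+
    then have "sym_difference (ancestors E x) (ancestors E y) = insert y (sym_difference (ancestors E x) (ancestors E i))"
      "y \<notin> sym_difference (ancestors E x) (ancestors E i)" using ancestors_child[OF assms(1) i] by auto
    moreover have "finite (sym_difference (ancestors E x) (ancestors E i))"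
      using finite_ancestors[OF assms(1)] that(1) iy(2) by simp
    ultimately show ?thesis using i iy by auto
  qed
  consider "u = w" | "u < w" | "w < u" by linarith
  then show ?case
  proof cases
    case 2
    from step[OF less.prems 2] obtain i where i: "i \<in> {1..n}" "i < w" "(i, w) \<in> E"
      "card (sym_difference (ancestors E u) (ancestors E w)) = Suc (card (sym_difference (ancestors E u) (ancestors E i)))" by blast
    have "(u, i) \<in> ?R ^^ card (sym_difference (ancestors E u) (ancestors E i))"
      using less.hyps[of u i] less.prems(1) i(1,2) by simp
    then show ?thesis unfolding i(4) using i(3) by (intro relpow_Suc_I) auto
  next
    case 3
    from step[OF less.prems(2,1) 3] obtain i where i: "i \<in> {1..n}" "i < u" "(i, u) \<in> E"
      "card (sym_difference (ancestors E w) (ancestors E u)) = Suc (card (sym_difference (ancestors E w) (ancestors E i)))" by blast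
    have "(i, w) \<in> ?R ^^ card (sym_difference (ancestors E i) (ancestors E w))"
      using less.hyps[of i w] less.prems(2) i(1,2) by simp
    moreover have "card (sym_difference (ancestors E u) (ancestors E w)) = Suc (card (sym_difference (ancestors E i) (ancestors E w)))"
      using i(4) by (simp only: Un_commute)
    ultimately show ?thesis using i(3) by (simp only:) (intro relpow_Suc_I2, auto)
  qed simp
qed

lemma tree_dist_symdiff:
  assumes "recursive_tree n (edges T)" "u \<in> {1..n}" "w \<in> {1..n}"
  shows "tree_dist T u w = card (sym_difference (ancestors (edges T) u) (ancestors (edges T) w))"
  unfolding tree_dist_def
  using walk_card_symdiff[OF assms] card_symdiff_le_walk[OF assms(1,2), of w]
  by (intro Least_equality) auto

text \<open>
  A node \<open>v\<close> contributes one to the distance of \<open>u\<close> and \<open>w\<close> iff it is an ancestor of exactly one of them.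
  Summed over \<open>w\<close>, the contribution is \<open>S v\<close> if \<open>v\<close> is not an ancestor of \<open>u\<close>, and \<open>n - S v\<close> otherwise.
\<close>

lemma sum_tree_dist:
  assumes "recursive_tree n (edges T)" "u \<in> {1..n}"
  shows "int (\<Sum>w = 1..n. tree_dist T u w) =
    (\<Sum>v = 1..n. int (card (descendants (edges T) v))) +
    (\<Sum>v\<in>ancestors (edges T) u. int n - 2 * int (card (descendants (edges T) v)))"
proof -
  let ?E = "edges T"
  let ?A = "ancestors ?E" and ?S = "\<lambda>v. int (card (descendants ?E v))"
  note sub = ancestors_subset[OF assms]
  have d: "int (tree_dist T u w) = (\<Sum>v = 1..n. of_bool (v \<in> sym_difference (?A u) (?A w)))"
    if "w \<in> {1..n}" for w
  proof -
    have "sym_difference (?A u) (?A w) \<subseteq> {1..n}" using sub ancestors_subset[OF assms(1) that] by blast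
    then have "{1..n} \<inter> {v. v \<in> sym_difference (?A u) (?A w)} = sym_difference (?A u) (?A w)" by blast
    then show ?thesis
      unfolding tree_dist_symdiff[OF assms that] by (simp only: sum_of_bool_eq finite_atLeastAtMost)
  qed
  have S: "(\<Sum>w = 1..n. of_bool (v \<in> ?A w)) = ?S v" if "v \<in> {1..n}" for v
  proof -
    have "{1..n} \<inter> {w. v \<in> ?A w} = descendants ?E v" using descendants_subset[OF assms(1) that] by (auto simp: mem_ancestors_iff)
    then show ?thesis by (simp only: sum_of_bool_eq finite_atLeastAtMost)
  qed
  have "int (\<Sum>w = 1..n. tree_dist T u w) = (\<Sum>w = 1..n. \<Sum>v = 1..n. of_bool (v \<in> sym_difference (?A u) (?A w)))"
    unfolding of_nat_sum by (intro sum.cong d refl) simp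
  also have "\<dots> = (\<Sum>v = 1..n. \<Sum>w = 1..n. of_bool (v \<in> sym_difference (?A u) (?A w)))" by (rule sum.swap)
  also have "\<dots> = (\<Sum>v = 1..n. ?S v + of_bool (v \<in> ?A u) * (int n - 2 * ?S v))"
  proof (rule sum.cong)
    fix v assume v: "v \<in> {1..n}"
    have "(\<Sum>w = 1..n. of_bool (v \<in> sym_difference (?A u) (?A w))) =
        (\<Sum>w = 1..n. of_bool (v \<in> ?A w) + of_bool (v \<in> ?A u) * (1 - 2 * of_bool (v \<in> ?A w)) :: int)"
      by (intro sum.cong) auto
    also have "\<dots> = ?S v + of_bool (v \<in> ?A u) * (int n - 2 * ?S v)"
      unfolding sum.distrib sum_distrib_left[symmetric] sum_subtractf S[OF v] by simp
    finally show "(\<Sum>w = 1..n. of_bool (v \<in> sym_difference (?A u) (?A w))) =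
      ?S v + of_bool (v \<in> ?A u) * (int n - 2 * ?S v)" .
  qed simp
  also have "\<dots> = (\<Sum>v = 1..n. ?S v) + (\<Sum>v\<in>{1..n} \<inter> ?A u. int n - 2 * ?S v)"
    unfolding sum.distrib
    by (subst sum.inter_restrict) (auto simp: of_bool_def if_distrib[of "\<lambda>a. a * _"] cong: if_cong)
  also have "{1..n} \<inter> ?A u = ?A u" using sub by blast
  finally show ?thesis .
qed

definition heavy_nodes :: "nat \<Rightarrow> (nat \<times> nat) set \<Rightarrow> nat set" where
  "heavy_nodes n E = {v \<in> {1..n}. n < 2 * card (descendants E v)}"

text \<open>
  Two subtrees that both contain more than half of all nodes intersect, so their roots are comparable.
  Hence the heavy nodes form a chain that starts at the root.
\<close>

lemma heavy_nodes_eq_ancestors: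
  assumes "recursive_tree n E"
  shows "Max (heavy_nodes n E) \<in> {1..n}" "heavy_nodes n E = ancestors E (Max (heavy_nodes n E))"
proof -
  let ?H = "heavy_nodes n E"
  have fin: "finite ?H" by (simp add: heavy_nodes_def)
  have "1 \<in> ?H" using root_descendants[OF assms] recursive_tree_size_pos[OF assms] by (simp add: heavy_nodes_def)
  then have c: "Max ?H \<in> ?H" using fin by (intro Max_in) auto
  then show c': "Max ?H \<in> {1..n}" by (simp add: heavy_nodes_def)
  show "?H = ancestors E (Max ?H)"
  proof (intro equalityI subsetI)
    fix v assume v: "v \<in> ?H"
    have v': "v \<in> {1..n}" using v by (simp add: heavy_nodes_def)
    have "descendants E v \<inter> descendants E (Max ?H) \<noteq> {}"
    proof
      assume "descendants E v \<inter> descendants E (Max ?H) = {}"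
      then have "card (descendants E v) + card (descendants E (Max ?H)) = card (descendants E v \<union> descendants E (Max ?H))"
        using finite_descendants[OF assms] v' c' by (intro card_Un_disjoint[symmetric]) auto
      also have "\<dots> \<le> card {1..n}"
        using descendants_subset[OF assms] v' c' by (intro card_mono) auto
      finally show False using v c by (simp add: heavy_nodes_def)
    qed
    then obtain w where "v \<in> ancestors E w" "Max ?H \<in> ancestors E w" by (auto simp: mem_ancestors_iff)
    then show "v \<in> ancestors E (Max ?H)" using Max_ge[OF fin v] by (rule ancestors_chain[OF assms])
  next
    fix v assume v: "v \<in> ancestors E (Max ?H)"
    then have v': "v \<in> {1..n}" using ancestors_subset[OF assms c'] by auto
    have "descendants E (Max ?H) \<subseteq> descendants E v"
      using v by (auto simp: ancestors_def descendants_def intro: rtrancl_trans)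
    then have "card (descendants E (Max ?H)) \<le> card (descendants E v)" by (intro card_mono finite_descendants[OF assms v'])
    then show "v \<in> ?H" using c v' by (simp add: heavy_nodes_def)
  qed
qed

text \<open>
  The summands \<open>n - 2 * S v\<close> in the sum of distances are negative exactly for heavy \<open>v\<close>, and the heavy
  nodes are the ancestors of the largest heavy node \<open>c\<close>. A node minimises the sum of distances iff all
  heavy nodes are among its ancestors and its other ancestors contribute zero. So \<open>c\<close> is a
  minimiser, and all other minimisers lie strictly below it.
\<close>

lemma centroid_label_eq:
  assumes "T \<in> increasing_trees n" "n \<ge> 1"
  shows "centroid_label T = Max (heavy_nodes n (edges T))"
proof -
  let ?E = "edges T"
  let ?A = "ancestors ?E" and ?c = "Max (heavy_nodes n ?E)" and ?g = "\<lambda>v. int n - 2 * int (card (descendants ?E v))"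
  let ?D = "\<lambda>u. \<Sum>w = 1..n. tree_dist T u w"
  have L: "set (labels T) = {1..n}" using assms(1) by (simp add: increasing_trees_def)
  have rt: "recursive_tree n ?E" by (rule recursive_tree_edges[OF assms])
  have root: "label T = 1"
    using label_least[of T 1] label_in_labels[of T] L assms by (auto simp: increasing_trees_def)
  note c = heavy_nodes_eq_ancestors[OF rt]
  have fin: "finite (?A u)" if "u \<in> {1..n}" for u by (rule finite_ancestors[OF rt that])
  have neg: "?g v < 0" if "v \<in> ?A ?c" for v using that unfolding c(2)[symmetric] by (simp add: heavy_nodes_def)
  have nonneg: "?g v \<ge> 0" if "v \<in> ?A u - ?A ?c" "u \<in> {1..n}" for u v
    using that ancestors_subset[OF rt that(2)] unfolding c(2)[symmetric] by (auto simp: heavy_nodes_def)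
  have diff: "int (?D u) - int (?D ?c) = sum ?g (?A u - ?A ?c) - sum ?g (?A ?c - ?A u)"
    if "u \<in> {1..n}" for u
  proof -
    have "sum ?g (?A u) = sum ?g (?A u - ?A ?c) + sum ?g (?A u \<inter> ?A ?c)"
      using sum.Int_Diff[OF fin[OF that], of ?g "?A ?c"] by simp
    moreover have "sum ?g (?A ?c) = sum ?g (?A ?c - ?A u) + sum ?g (?A u \<inter> ?A ?c)"
      using sum.Int_Diff[OF fin[OF c(1)], of ?g "?A u"] by (simp add: Int_commute)
    ultimately show ?thesis unfolding sum_tree_dist[OF rt that] sum_tree_dist[OF rt c(1)] by simp
  qed
  \<comment> \<open>The ancestors of \<open>u\<close> beyond the heavy nodes can only increase the sum of distances.\<close>
  have up: "sum ?g (?A u - ?A ?c) \<ge> 0" if "u \<in> {1..n}" for u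
    using nonneg[OF _ that] by (intro sum_nonneg) blast
  have min: "?D ?c \<le> ?D u" if "u \<in> {1..n}" for u
  proof -
    have "sum ?g (?A ?c - ?A u) \<le> 0" using neg by (intro sum_nonpos) (simp add: less_imp_le)
    then show ?thesis using diff[OF that] up[OF that] by linarith
  qed
  have sub: "?A ?c \<subseteq> ?A u" if "u \<in> {1..n}" "?D u \<le> ?D ?c" for u
  proof (rule ccontr)
    assume "\<not> ?A ?c \<subseteq> ?A u"
    then have "?A ?c - ?A u \<noteq> {}" by blast
    then have "sum ?g (?A ?c - ?A u) < sum (\<lambda>_. 0) (?A ?c - ?A u)"
      using neg fin[OF c(1)] by (intro sum_strict_mono) auto
    then show False using diff[OF that(1)] up[OF that(1)] that(2) by simp
  qed
  have cen: "is_centroid T u \<longleftrightarrow> u \<in> {1..n} \<and> (\<forall>y\<in>{1..n}. ?D u \<le> ?D y)" for u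
    unfolding is_centroid_def is_arg_min_def L by (auto simp: not_less)
  have cc: "is_centroid T ?c" unfolding cen using min c(1) by blast
  \<comment> \<open>The distance to the root is the number of proper ancestors.\<close>
  have depth: "tree_dist T (label T) u = card (?A u) - 1" if "u \<in> {1..n}" for u
  proof -
    have "sym_difference (?A 1) (?A u) = ?A u - {1}"
      using ancestors_root[OF rt] root_ancestors[OF rt that] by auto
    then show ?thesis
      unfolding root using tree_dist_symdiff[OF rt _ that, of 1] assms(2) root_ancestors[OF rt that] fin[OF that]
      by (simp add: card_Diff_singleton)
  qed
  have pos: "card (?A u) \<ge> 1" if "u \<in> {1..n}" for u
    using ancestors_self[of u ?E] fin[OF that] by (simp add: Suc_le_eq card_gt_0_iff) blast
  have far: "tree_dist T (label T) ?c < tree_dist T (label T) u" if u: "is_centroid T u" "u \<noteq> ?c" for u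
  proof -
    have u1: "u \<in> {1..n}" "?D u \<le> ?D ?c" using u(1) c(1) unfolding cen by auto
    have "?A ?c \<noteq> ?A u" using ancestors_inj[OF rt, of ?c u] u(2) by blast
    then have "?A ?c \<subset> ?A u" using sub[OF u1] by blast
    then have "card (?A ?c) < card (?A u)" by (rule psubset_card_mono[OF fin[OF u1(1)]])
    then show ?thesis unfolding depth[OF c(1)] depth[OF u1(1)] using pos[OF c(1)] by simp
  qed
  show ?thesis
    unfolding centroid_label_def arg_min_def
  proof (rule some_equality)
    show "is_arg_min (tree_dist T (label T)) (is_centroid T) ?c"
      unfolding is_arg_min_def using cc far by (metis less_asym less_irrefl)
    show "u = ?c" if "is_arg_min (tree_dist T (label T)) (is_centroid T) u" for u
      using that cc far unfolding is_arg_min_def by blast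
  qed
qed

text \<open>
  A heavy node other than the last one has exactly one heavy child. Written as a linear
  combination of indicators, the event \<open>L = k\<close> is accessible to expectations of single subtree sizes.
\<close>

lemma centroid_indicator:
  assumes "recursive_tree n E" "k \<in> {1..n}"
  shows "of_bool (Max (heavy_nodes n E) = k) =
    (of_bool (k \<in> heavy_nodes n E) - (\<Sum>j\<in>E `` {k}. of_bool (j \<in> heavy_nodes n E)) :: real)"
proof -
  note c = heavy_nodes_eq_ancestors[OF assms(1)]
  let ?c = "Max (heavy_nodes n E)"
  let ?J = "E `` {k} \<inter> ancestors E ?c"
  have par: "k \<in> ancestors E ?c" if "j \<in> ?J" for j
    using that by (auto simp: ancestors_def intro: converse_rtrancl_into_rtrancl)
  have gt: "k < j" if "j \<in> ?J" for j using that recursive_tree_edge(2)[OF assms(1)] by auto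
  have s: "(\<Sum>j\<in>E `` {k}. of_bool (j \<in> heavy_nodes n E)) = real (card ?J)"
    unfolding c(2)[symmetric] using finite_children[OF assms(1)] by (simp add: sum_of_bool_eq)
  have cd: "card ?J = of_bool (k \<in> ancestors E ?c \<and> k \<noteq> ?c)"
  proof (cases "k \<in> ancestors E ?c \<and> k \<noteq> ?c")
    case True
    then have "(k, ?c) \<in> E\<^sup>*" "k \<noteq> ?c" by (simp_all add: ancestors_def)
    then obtain j where j: "(k, j) \<in> E" "(j, ?c) \<in> E\<^sup>*" by (meson converse_rtranclE)
    have J: "j \<in> ?J" using j by (simp add: ancestors_def)
    have "j' = j" if "j' \<in> ?J" for j'
    proof -
      have eq: "x = y" if "x \<in> ?J" "y \<in> ?J" "x \<le> y" for x y
      proof -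
        have "x \<in> ancestors E y" using ancestors_chain[OF assms(1)] that by blast
        moreover have "ancestors E y = insert y (ancestors E k)" using ancestors_child[OF assms(1)] that(2) by blast
        moreover have "x \<notin> ancestors E k" using ancestors_le[OF assms(1)] gt[OF that(1)] by force
        ultimately show ?thesis by simp
      qed
      show ?thesis using eq[OF J that] eq[OF that J] by linarith
    qed
    then have "?J = {j}" using J by blast
    then show ?thesis using True by simp
  next
    case False
    have "?J = {}"
    proof (rule ccontr)
      assume "?J \<noteq> {}"
      then obtain j where j: "j \<in> ?J" by blast
      then have "k = ?c" using False par by blast
      moreover have "j \<le> ?c" using j ancestors_le[OF assms(1)] by blast
      ultimately show False using gt[OF j] by simp
    qed
    then show ?thesis using False by simp
  qed
  have "k \<in> heavy_nodes n E \<longleftrightarrow> k \<in> ancestors E ?c" using c(2) by blast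
  moreover have "k \<in> ancestors E ?c" if "?c = k" using ancestors_self[of ?c E] that by simp
  ultimately show ?thesis unfolding s cd by (cases "?c = k") simp_all
qed

section \<open>Polya urn counts\<close>

text \<open>
  In a Polya urn with initial contents \<open>a\<close> and \<open>b\<close> where each draw adds one ball of the drawn colour,
  this is the probability of drawing the first colour \<open>j\<close> times out of \<open>m\<close>, multiplied by the
  normalising factor \<open>pochhammer (a + b) m\<close>.
\<close>

definition polya :: "real \<Rightarrow> real \<Rightarrow> nat \<Rightarrow> nat \<Rightarrow> real" where
  "polya a b m j = real (m choose j) * pochhammer a j * pochhammer b (m - j)"

text \<open>
  The expected number of children with a subtree of size \<open>j + 1\<close>, up to normalisation. It obeys the
  recurrence of the urn with a source term, since new children keep appearing.
\<close>

definition polya_child :: "real \<Rightarrow> real \<Rightarrow> nat \<Rightarrow> nat \<Rightarrow> real" where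
  "polya_child a b m j = real (m choose Suc j) * pochhammer a j * pochhammer b (m - Suc j)"

lemma choose_mult_pochhammer_Suc:
  "real (m choose j) * pochhammer b (Suc m - j) =
    real (m choose j) * pochhammer b (m - j) * (b + real m - real j)"
proof (cases "j \<le> m")
  case True
  then show ?thesis by (simp add: Suc_diff_le pochhammer_Suc of_nat_diff)
qed simp

lemma polya_Suc_0: "polya a b (Suc m) 0 = (b + m) * polya a b m 0"
  by (simp add: polya_def pochhammer_Suc)

text \<open>
  Pascal's rule, arranged by the effect of the last draw. The recurrences below have the same shape as
  the growth step.
\<close>

lemma polya_Suc_Suc:
  "polya a b (Suc m) (Suc i) = (b + m - Suc i) * polya a b m (Suc i) + (a + i) * polya a b m i"
proof -
  have "polya a b (Suc m) (Suc i) = pochhammer a (Suc i) *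
      (real (m choose Suc i) * pochhammer b (Suc m - Suc i)) +
      real (m choose i) * pochhammer a (Suc i) * pochhammer b (m - i)"
    by (simp add: polya_def algebra_simps)
  then show ?thesis
    unfolding choose_mult_pochhammer_Suc by (simp add: polya_def pochhammer_Suc mult_ac)
qed

lemma polya_child_Suc_0:
  "polya_child a b (Suc m) 0 = (b + m - 1) * polya_child a b m 0 + pochhammer b m"
proof -
  have "polya_child a b (Suc m) 0 = real (m choose 1) * pochhammer b (Suc m - 1) + pochhammer b m"
    by (simp add: polya_child_def algebra_simps)
  then show ?thesis unfolding choose_mult_pochhammer_Suc by (simp add: polya_child_def mult_ac)
qed

lemma polya_child_Suc_Suc:
  "polya_child a b (Suc m) (Suc i) =
    (b + m - Suc (Suc i)) * polya_child a b m (Suc i) + (a + i) * polya_child a b m i"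
proof -
  have "polya_child a b (Suc m) (Suc i) = pochhammer a (Suc i) *
      (real (m choose Suc (Suc i)) * pochhammer b (Suc m - Suc (Suc i))) +
      real (m choose Suc i) * pochhammer a (Suc i) * pochhammer b (m - Suc i)"
    by (simp add: polya_child_def algebra_simps)
  then show ?thesis
    unfolding choose_mult_pochhammer_Suc by (simp add: polya_child_def pochhammer_Suc mult_ac)
qed

section \<open>Expectations over random trees\<close>

locale very_simple_family =
  fixes c1 c2 \<alpha> :: real
  assumes very_simple: "very_simple c1 c2 \<alpha>"
begin

abbreviation \<phi> where "\<phi> \<equiv> degree_fps c1 c2"

lemma alpha_pos: "\<alpha> > 0" and alpha_le: "\<alpha> \<le> 2"
  using very_simple_bounds[OF very_simple] .

text \<open>
  Coefficient form of \<open>(1 + c2 * u) * \<phi>' = (c1 + c2) * \<phi>\<close>, with \<open>\<phi>\<^sub>0 = 1\<close>.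
\<close>

lemma degree_fps_step:
  "real (Suc k) * fps_nth \<phi> (Suc k) * fps_nth \<phi> 0 = c1 * (\<alpha> - (\<alpha> - 1) * k) * fps_nth \<phi> k"
proof (cases "c2 = 0")
  case True
  then have "\<alpha> = 1" using very_simple by (simp add: very_simple_def)
  then show ?thesis using True by (simp add: fps_nth_degree_fps del: of_nat_Suc)
next
  case False
  have c1: "c1 * \<alpha> = c1 + c2" using very_simple by (auto simp: very_simple_def field_simps)
  have "real (Suc k) * ((1 + c1 / c2) gchoose Suc k) = (1 + c1 / c2 - k) * ((1 + c1 / c2) gchoose k)"
    by (simp add: gbinomial_prod_rev field_simps del: of_nat_Suc)
  then have "real (Suc k) * ((1 + c1 / c2) gchoose Suc k) * c2 ^ Suc k =
      (1 + c1 / c2 - k) * c2 * (((1 + c1 / c2) gchoose k) * c2 ^ k)" by simp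
  also have "(1 + c1 / c2 - k) * c2 = c1 * \<alpha> - (c1 * \<alpha> - c1) * k"
    unfolding c1 using False by (simp add: field_simps)
  also have "\<dots> = c1 * (\<alpha> - (\<alpha> - 1) * k)" by (simp add: algebra_simps)
  finally show ?thesis using False by (simp add: fps_nth_degree_fps mult.assoc)
qed

text \<open>
  Everything about centroids is determined by the edges, so only functions of the edge set are averaged.
\<close>

definition edge_mean :: "nat \<Rightarrow> ((nat \<times> nat) set \<Rightarrow> real) \<Rightarrow> real" where
  "edge_mean n F = edge_sum \<phi> n F / total_weight \<phi> n"

lemma expectation_edges:
  assumes "n \<ge> 1" "\<And>T. T \<in> increasing_trees n \<Longrightarrow> f T = F (edges T)"
  shows "measure_pmf.expectation (random_tree c1 c2 n) f = edge_mean n F"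
proof -
  have "measure_pmf.expectation (random_tree c1 c2 n) f =
      (\<Sum>T\<in>increasing_trees n. f T * pmf (random_tree c1 c2 n) T)"
    by (rule integral_measure_pmf_real[OF finite_increasing_trees])
       (auto simp: set_pmf_eq pmf_random_tree[OF very_simple assms(1)] split: if_splits)
  also have "\<dots> = edge_mean n F"
    unfolding edge_mean_def edge_sum_def sum_divide_distrib
    by (intro sum.cong) (simp_all add: pmf_random_tree[OF very_simple assms(1)] assms(2) mult_ac)
  finally show ?thesis .
qed

lemma edge_mean_nonneg:
  assumes "n \<ge> 1" "\<And>E. F E \<ge> 0" shows "edge_mean n F \<ge> 0"
  unfolding edge_mean_def edge_sum_def
  using total_weight_pos[OF very_simple assms(1)] weight_nonneg[OF degree_fps_nonneg[OF very_simple]] assms(2)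
  by (intro divide_nonneg_pos sum_nonneg mult_nonneg_nonneg) auto

lemma edge_mean_cong:
  assumes "n \<ge> 1" "\<And>E. recursive_tree n E \<Longrightarrow> F E = G E"
  shows "edge_mean n F = edge_mean n G"
  unfolding edge_mean_def edge_sum_def
  using recursive_tree_edges[OF _ assms(1)] assms(2) by (metis (no_types, lifting) sum.cong)

lemma edge_mean_add: "edge_mean n (\<lambda>E. F E + G E) = edge_mean n F + edge_mean n G"
  by (simp add: edge_mean_def edge_sum_def distrib_left sum.distrib add_divide_distrib)

lemma edge_mean_mult: "edge_mean n (\<lambda>E. c * F E) = c * edge_mean n F"
  by (simp add: edge_mean_def edge_sum_def sum_distrib_left mult_ac)

lemma edge_mean_diff: "edge_mean n (\<lambda>E. F E - G E) = edge_mean n F - edge_mean n G"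
  by (simp add: edge_mean_def edge_sum_def right_diff_distrib sum_subtractf diff_divide_distrib)

lemma edge_mean_sum: "edge_mean n (\<lambda>E. \<Sum>i\<in>I. F i E) = (\<Sum>i\<in>I. edge_mean n (F i))"
  unfolding edge_mean_def edge_sum_def
  by (simp add: sum_distrib_left sum_divide_distrib) (rule sum.swap)

lemma edge_mean_const:
  assumes "n \<ge> 1" shows "edge_mean n (\<lambda>E. c) = c"
  using total_weight_pos[OF very_simple assms]
  by (simp add: edge_mean_def edge_sum_def total_weight_def flip: sum_distrib_right)

text \<open>
  The growth process: node \<open>n + 1\<close> is attached to \<open>v\<close> with probability
  \<open>(\<alpha> - (\<alpha> - 1) * d) / (n + \<alpha> - 1)\<close>, where \<open>d\<close> is the current outdegree of \<open>v\<close>. The normalisation is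
  found by inserting the constant function \<open>1\<close> for \<open>F\<close>.
\<close>

lemma edge_mean_Suc:
  assumes "n \<ge> 1"
  shows "edge_mean (Suc n) F =
    edge_mean n (\<lambda>E. \<Sum>v = 1..n. (\<alpha> - (\<alpha> - 1) * card (E `` {v})) * F (insert (v, Suc n) E)) /
    (n + \<alpha> - 1)"
proof -
  let ?G = "\<lambda>F E. \<Sum>v = 1..n. (\<alpha> - (\<alpha> - 1) * card (E `` {v})) * F (insert (v, Suc n) E)"
  have c1: "c1 > 0" using very_simple by (simp add: very_simple_def)
  have n: "n + \<alpha> - 1 > 0" using alpha_pos assms by simp
  have step: "edge_sum \<phi> (Suc n) F = c1 * edge_sum \<phi> n (?G F)" for F
  proof -
    have "edge_sum \<phi> (Suc n) F =
        edge_sum \<phi> n (\<lambda>E. \<Sum>v = 1..n. c1 * (\<alpha> - (\<alpha> - 1) * card (E `` {v})) * F (insert (v, Suc n) E))"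
      by (rule edge_sum_Suc[OF degree_fps_step assms])
    also have "\<dots> = c1 * edge_sum \<phi> n (?G F)"
      by (simp add: edge_sum_def sum_distrib_left mult_ac)
    finally show ?thesis .
  qed
  have "total_weight \<phi> (Suc n) = edge_sum \<phi> (Suc n) (\<lambda>_. 1)"
    by (simp add: edge_sum_def total_weight_def)
  also have "\<dots> = c1 * (edge_mean n (?G (\<lambda>_. 1)) * total_weight \<phi> n)"
    unfolding step edge_mean_def using total_weight_pos[OF very_simple assms] by simp
  also have "edge_mean n (?G (\<lambda>_. 1)) = edge_mean n (\<lambda>_. n + \<alpha> - 1)"
    by (rule edge_mean_cong[OF assms]) (simp only: mult_1_right attraction_total)
  also have "\<dots> = n + \<alpha> - 1" by (rule edge_mean_const[OF assms])
  finally show ?thesis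
    unfolding edge_mean_def[of "Suc n"] step edge_mean_def[of n] using c1 n by simp
qed

lemma mean_outdegree:
  assumes "k \<ge> 1"
  shows "edge_mean (k + m) (\<lambda>E. \<alpha> - (\<alpha> - 1) * card (E `` {k})) =
    \<alpha> * pochhammer (real k) m / pochhammer (k + \<alpha> - 1) m"
proof (induction m)
  case 0
  have "E `` {k} = {}" if "recursive_tree k E" for E
    using recursive_tree_edge(2,3)[OF that] by force
  then have "edge_mean k (\<lambda>E. \<alpha> - (\<alpha> - 1) * card (E `` {k})) = edge_mean k (\<lambda>E. \<alpha>)"
    using assms by (intro edge_mean_cong) simp_all
  then show ?case using edge_mean_const[OF assms] by simp
next
  case (Suc m)
  let ?n = "k + m"
  have n: "?n \<ge> 1" "k \<in> {1..?n}" using assms by auto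
  have "edge_mean (Suc ?n) (\<lambda>E. \<alpha> - (\<alpha> - 1) * card (E `` {k})) =
      edge_mean ?n (\<lambda>E. real ?n * (\<alpha> - (\<alpha> - 1) * card (E `` {k}))) / (?n + \<alpha> - 1)"
    unfolding edge_mean_Suc[OF n(1)]
    by (intro arg_cong2[where f = "(/)"] edge_mean_cong[OF n(1)] growth_outdegree[OF _ n(2)] refl)
  then show ?case
    unfolding edge_mean_mult Suc.IH by (simp add: pochhammer_Suc algebra_simps)
qed

text \<open>
  When node \<open>k\<close> is born, its subtree attracts with weight \<open>\<alpha>\<close> and all other nodes together with weight
  \<open>k - 1\<close>. From then on each attracted node adds one to the weight of its side, as in a Polya urn.
\<close>

lemma mean_subtree_size:
  assumes "k \<ge> 1"
  shows "edge_mean (k + m) (\<lambda>E. of_bool (card (descendants E k) = Suc j)) =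
    polya \<alpha> (real k - 1) m j / pochhammer (k + \<alpha> - 1) m"
proof (induction m arbitrary: j)
  case 0
  have "card (descendants E k) = 1" if "recursive_tree k E" for E
  proof -
    have "descendants E k = {k}"
      using descendants_subset[OF that, of k] recursive_tree_reach_le[OF that, of k] assms descendants_self[of k E]
      by (force simp: descendants_def)
    then show ?thesis by simp
  qed
  then have "edge_mean k (\<lambda>E. of_bool (card (descendants E k) = Suc j)) = edge_mean k (\<lambda>E. of_bool (j = 0))"
    using assms by (intro edge_mean_cong) simp_all
  then show ?case using edge_mean_const[OF assms] by (cases j) (simp_all add: polya_def)
next
  case (Suc m)
  let ?n = "k + m" and ?F = "\<lambda>j E. of_bool (card (descendants E k) = Suc j) :: real"
  have n: "?n \<ge> 1" "k \<in> {1..?n}" using assms by auto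
  have pos: "card (descendants E k) \<noteq> 0" if "recursive_tree ?n E" for E
    using descendants_self[of k E] finite_descendants[OF that n(2)] by auto
  show ?case
  proof (cases j)
    case 0
    have "edge_mean (Suc ?n) (?F 0) = edge_mean ?n (\<lambda>E. (real ?n - 1) * ?F 0 E) / (?n + \<alpha> - 1)"
      unfolding edge_mean_Suc[OF n(1)]
    proof (intro arg_cong2[where f = "(/)"] edge_mean_cong[OF n(1)] refl)
      fix E assume E: "recursive_tree ?n E"
      show "(\<Sum>v = 1..?n. (\<alpha> - (\<alpha> - 1) * card (E `` {v})) * ?F 0 (insert (v, Suc ?n) E)) =
          (real ?n - 1) * ?F 0 E"
        unfolding growth_subtree[OF E n(2), where h = "\<lambda>s. of_bool (s = Suc 0)"]
        using pos[OF E] by simp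
    qed
    also have "\<dots> = (real k - 1 + m) * polya \<alpha> (real k - 1) m 0 /
        (pochhammer (k + \<alpha> - 1) m * (k + \<alpha> - 1 + m))"
      unfolding edge_mean_mult Suc.IH by (simp add: algebra_simps)
    finally show ?thesis using 0 by (simp add: polya_Suc_0 pochhammer_Suc)
  next
    case (Suc i)
    have "edge_mean (Suc ?n) (?F j) =
        edge_mean ?n (\<lambda>E. (real ?n - Suc j) * ?F j E + (\<alpha> + i) * ?F i E) / (?n + \<alpha> - 1)"
      unfolding edge_mean_Suc[OF n(1)]
    proof (intro arg_cong2[where f = "(/)"] edge_mean_cong[OF n(1)] refl)
      fix E assume E: "recursive_tree ?n E"
      show "(\<Sum>v = 1..?n. (\<alpha> - (\<alpha> - 1) * card (E `` {v})) * ?F j (insert (v, Suc ?n) E)) =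
          (real ?n - Suc j) * ?F j E + (\<alpha> + i) * ?F i E"
        unfolding growth_subtree[OF E n(2), where h = "\<lambda>s. of_bool (s = Suc j)"]
        by (simp add: Suc)
    qed
    also have "\<dots> = ((real k - 1 + m - Suc i) * polya \<alpha> (real k - 1) m (Suc i) +
        (\<alpha> + i) * polya \<alpha> (real k - 1) m i) / (pochhammer (k + \<alpha> - 1) m * (k + \<alpha> - 1 + m))"
      unfolding edge_mean_add edge_mean_mult Suc.IH
      by (simp add: Suc add_divide_distrib diff_divide_distrib algebra_simps)
    finally show ?thesis by (simp add: Suc polya_Suc_Suc pochhammer_Suc)
  qed
qed

text \<open>
  Existing children of \<open>k\<close> follow the urn dynamics of their subtrees, and new children are born at the
  rate given by \<open>mean_outdegree\<close>.
\<close>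

lemma mean_child_sizes:
  assumes "k \<ge> 1"
  shows "edge_mean (k + m) (\<lambda>E. \<Sum>c\<in>E `` {k}. of_bool (card (descendants E c) = Suc j)) =
    \<alpha> * polya_child \<alpha> k m j / pochhammer (k + \<alpha> - 1) m"
proof (induction m arbitrary: j)
  case 0
  have "E `` {k} = {}" if "recursive_tree k E" for E
    using recursive_tree_edge(2,3)[OF that] by force
  then have "edge_mean k (\<lambda>E. \<Sum>c\<in>E `` {k}. of_bool (card (descendants E c) = Suc j)) = edge_mean k (\<lambda>E. 0)"
    using assms by (intro edge_mean_cong) simp_all
  then show ?case using edge_mean_const[OF assms] by (simp add: polya_child_def)
next
  case (Suc m)
  let ?n = "k + m" and ?F = "\<lambda>j E. \<Sum>c\<in>E `` {k}. of_bool (card (descendants E c) = Suc j) :: real"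
  let ?q = "\<lambda>E. \<alpha> - (\<alpha> - 1) * card (E `` {k})"
  have n: "?n \<ge> 1" "k \<in> {1..?n}" using assms by auto
  have pos: "card (descendants E c) \<noteq> 0" if "recursive_tree ?n E" "c \<in> E `` {k}" for E c
  proof -
    have "c \<in> {1..?n}" using recursive_tree_edge[OF that(1), of k c] that(2) by auto
    then show ?thesis using descendants_self[of c E] finite_descendants[OF that(1)] by auto
  qed
  show ?case
  proof (cases j)
    case 0
    have "edge_mean (Suc ?n) (?F 0) = edge_mean ?n (\<lambda>E. (real ?n - 1) * ?F 0 E + ?q E) / (?n + \<alpha> - 1)"
      unfolding edge_mean_Suc[OF n(1)]
    proof (intro arg_cong2[where f = "(/)"] edge_mean_cong[OF n(1)] refl)
      fix E assume E: "recursive_tree ?n E"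
      show "(\<Sum>v = 1..?n. (\<alpha> - (\<alpha> - 1) * card (E `` {v})) * ?F 0 (insert (v, Suc ?n) E)) =
          (real ?n - 1) * ?F 0 E + ?q E"
        unfolding growth_children[OF E n(2), where h = "\<lambda>s. of_bool (s = Suc 0)"]
        unfolding sum_distrib_left using pos[OF E] by (intro arg_cong2[where f = "(+)"] sum.cong) auto
    qed
    also have "\<dots> = \<alpha> * ((real k + m - 1) * polya_child \<alpha> k m 0 + pochhammer (real k) m) /
        (pochhammer (k + \<alpha> - 1) m * (k + \<alpha> - 1 + m))"
      unfolding edge_mean_add edge_mean_mult Suc.IH mean_outdegree[OF assms]
      by (simp add: add_divide_distrib diff_divide_distrib algebra_simps)
    finally show ?thesis using 0 by (simp add: polya_child_Suc_0 pochhammer_Suc)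
  next
    case (Suc i)
    have "edge_mean (Suc ?n) (?F j) =
        edge_mean ?n (\<lambda>E. (real ?n - Suc j) * ?F j E + (\<alpha> + i) * ?F i E) / (?n + \<alpha> - 1)"
      unfolding edge_mean_Suc[OF n(1)]
    proof (intro arg_cong2[where f = "(/)"] edge_mean_cong[OF n(1)] refl)
      fix E assume E: "recursive_tree ?n E"
      show "(\<Sum>v = 1..?n. (\<alpha> - (\<alpha> - 1) * card (E `` {v})) * ?F j (insert (v, Suc ?n) E)) =
          (real ?n - Suc j) * ?F j E + (\<alpha> + i) * ?F i E"
        unfolding growth_children[OF E n(2), where h = "\<lambda>s. of_bool (s = Suc j)"]
        unfolding sum_distrib_left sum.distrib[symmetric] by (simp add: Suc, intro sum.cong refl, auto)
    qed
    also have "\<dots> = \<alpha> * ((real k + m - Suc (Suc i)) * polya_child \<alpha> k m (Suc i) +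
        (\<alpha> + i) * polya_child \<alpha> k m i) / (pochhammer (k + \<alpha> - 1) m * (k + \<alpha> - 1 + m))"
      unfolding edge_mean_add edge_mean_mult Suc.IH
      by (simp add: Suc add_divide_distrib diff_divide_distrib algebra_simps)
    finally show ?thesis by (simp add: Suc polya_child_Suc_Suc pochhammer_Suc)
  qed
qed

end

section \<open>The law of the centroid label\<close>

lemma choose_Suc_mult: "real (m choose j) * (real m - j) = real (m choose Suc j) * real (Suc j)"
proof (cases "j \<le> m")
  case True
  have "(m - j) * (m choose j) = Suc j * (m choose Suc j)"
    unfolding binomial_absorb_comp binomial_absorption ..
  then have "real ((m - j) * (m choose j)) = real (Suc j * (m choose Suc j))" by (simp only:)
  then show ?thesis using True by (simp add: of_nat_diff algebra_simps)
qed (simp add: binomial_eq_0)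

text \<open>
  Discrete integration by parts in \<open>j\<close>: the urn with contents \<open>b - 1\<close> is compared with the one with
  contents \<open>b\<close>. After this, only one kind of sum is left, that over \<open>polya_child\<close>.
\<close>

lemma polya_telescope:
  "polya a (b - 1) m j - a * polya_child a b m j =
    polya a b m j - polya a b m (Suc j) - polya_child a b m j"
proof (cases "j < m")
  case True
  define i where "i = m - Suc j"
  have i: "m - j = Suc i" "m - Suc j = i" "real m = real j + real i + 1"
    using True by (auto simp: i_def)
  let ?C = "real (m choose j)" and ?D = "real (m choose Suc j)"
  have CD: "?C * (i + 1) = ?D * (j + 1)" using choose_Suc_mult[of m j] i(3) by (simp add: algebra_simps)
  have p: "pochhammer (b - 1) (Suc i) = (b - 1) * pochhammer b i" by (simp add: pochhammer_rec)
  have "polya a b m j - polya a (b - 1) m j = ?C * (i + 1) * pochhammer a j * pochhammer b i"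
    unfolding polya_def i p by (simp add: pochhammer_Suc algebra_simps)
  moreover have "polya a b m (Suc j) = ?D * (a + j) * pochhammer a j * pochhammer b i"
    unfolding polya_def i by (simp add: pochhammer_Suc)
  moreover have "polya_child a b m j = ?D * pochhammer a j * pochhammer b i"
    unfolding polya_child_def i ..
  ultimately show ?thesis unfolding CD by (simp add: algebra_simps)
next
  case False
  then show ?thesis by (cases "j = m") (simp_all add: polya_def polya_child_def binomial_eq_0)
qed

text \<open>
  The sums over \<open>polya_child\<close> for two consecutive labels (\<open>b\<close> and \<open>b + 1\<close>) differ by a telescoping sum.
\<close>

lemma polya_child_shift:
  "polya_child a b (Suc m) j - (a + b - 1) * polya_child a (b + 1) m j =
    polya a (b + 1) m j - polya a (b + 1) m (Suc j)"
proof (cases "j < m")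
  case True
  define i where "i = m - Suc j"
  have i: "m - j = Suc i" "m - Suc j = i" "Suc m - Suc j = Suc i" "real m = real j + real i + 1"
    using True by (auto simp: i_def)
  let ?C = "real (m choose j)" and ?D = "real (m choose Suc j)"
  have CD: "?C * (i + 1) = ?D * (j + 1)" using choose_Suc_mult[of m j] i(4) by (simp add: algebra_simps)
  define X where "X = pochhammer a j * pochhammer (b + 1) i"
  have "polya_child a b (Suc m) j = (?C + ?D) * b * X"
    unfolding polya_child_def i X_def pochhammer_rec[of b] by (simp add: mult_ac)
  moreover have "polya_child a (b + 1) m j = ?D * X"
    unfolding polya_child_def i X_def by simp
  moreover have "polya a (b + 1) m j = (?C * b + ?C * (i + 1)) * X"
    unfolding polya_def i X_def by (simp add: pochhammer_Suc algebra_simps)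
  moreover have "polya a (b + 1) m (Suc j) = ?D * (a + j) * X"
    unfolding polya_def i X_def by (simp add: pochhammer_Suc)
  ultimately show ?thesis unfolding CD by (simp add: algebra_simps)
next
  case False
  then show ?thesis by (cases "j = m") (simp_all add: polya_def polya_child_def binomial_eq_0)
qed

lemma polya_eq_0: "m < j \<Longrightarrow> polya a b m j = 0"
  by (simp add: polya_def binomial_eq_0)

lemma sum_telescope_to_0:
  fixes f :: "nat \<Rightarrow> real"
  assumes "h \<le> n" "f n = 0"
  shows "(\<Sum>j = h..<n. f j - f (Suc j)) = f h"
  using sum_Suc_diff'[OF assms(1), of f] assms(2)
  by (simp add: sum_subtractf)

text \<open>
  The coefficient of \<open>t ^ i\<close> in the binomial series of \<open>(1 - t) powr (- \<alpha>)\<close>.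
\<close>

definition rising_coeff :: "real \<Rightarrow> nat \<Rightarrow> real" where
  "rising_coeff \<alpha> i = pochhammer \<alpha> i / fact i"

context very_simple_family
begin

text \<open>
  The part of the sum over all subtree sizes greater than \<open>n div 2\<close> that telescopes: its value at the
  lower end.
\<close>

definition boundary_term :: "nat \<Rightarrow> nat \<Rightarrow> real" where
  "boundary_term n k = polya \<alpha> k (n - k) (n div 2) / pochhammer (\<alpha> + k - 1) (n - k)"

text \<open>
  The part of the same sum that does not telescope in the subtree size. It does so in the label \<open>k\<close>.
\<close>

definition correction_term :: "nat \<Rightarrow> nat \<Rightarrow> real" where
  "correction_term n k = (\<Sum>j = n div 2..<n. polya_child \<alpha> k (n - k) j) / pochhammer (\<alpha> + k - 1) (n - k)"

definition centroid_prob :: "nat \<Rightarrow> nat \<Rightarrow> real" where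
  "centroid_prob n k = edge_mean n (\<lambda>E. of_bool (Max (heavy_nodes n E) = k))"

text \<open>
  A node is heavy iff its subtree has size \<open>j + 1\<close> for some \<open>j\<close> between \<open>n div 2\<close> and \<open>n - 1\<close>. Summing
  the two laws over these \<open>j\<close> gives the law of the centroid label by \<open>polya_telescope\<close>.
\<close>

lemma centroid_prob_eq:
  assumes "1 \<le> k" "k \<le> n"
  shows "centroid_prob n k = boundary_term n k - correction_term n k"
proof -
  define m where "m = n - k"
  have n: "n = k + m" "n \<ge> 1" "k \<in> {1..n}" using assms by (auto simp: m_def)
  let ?h = "n div 2" and ?p = "pochhammer (\<alpha> + k - 1) m"
  have hv: "of_bool (c \<in> heavy_nodes n E) = (\<Sum>j = ?h..<n. of_bool (card (descendants E c) = Suc j) :: real)"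
    if "recursive_tree n E" "c \<in> {1..n}" for E c
  proof -
    let ?s = "card (descendants E c)"
    have s: "1 \<le> ?s" "?s \<le> n"
      using descendants_self[of c E] finite_descendants[OF that] card_mono[OF _ descendants_subset[OF that]]
      by (auto simp: Suc_le_eq card_gt_0_iff)
    then obtain i where i: "?s = Suc i" by (cases ?s) auto
    have "c \<in> heavy_nodes n E \<longleftrightarrow> i \<in> {?h..<n}" using that(2) s i by (auto simp: heavy_nodes_def)
    then show ?thesis unfolding i by (simp add: of_bool_def)
  qed
  have "centroid_prob n k = edge_mean n (\<lambda>E. \<Sum>j = ?h..<n. of_bool (card (descendants E k) = Suc j) -
      (\<Sum>c\<in>E `` {k}. of_bool (card (descendants E c) = Suc j)))"
    unfolding centroid_prob_def
  proof (rule edge_mean_cong[OF n(2)])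
    fix E assume E: "recursive_tree n E"
    have "(\<Sum>c\<in>E `` {k}. of_bool (c \<in> heavy_nodes n E)) =
        (\<Sum>c\<in>E `` {k}. \<Sum>j = ?h..<n. of_bool (card (descendants E c) = Suc j) :: real)"
    proof (intro sum.cong refl hv[OF E])
      fix c assume "c \<in> E `` {k}"
      then show "c \<in> {1..n}" using recursive_tree_edge[OF E, of k c] by auto
    qed
    also have "\<dots> = (\<Sum>j = ?h..<n. \<Sum>c\<in>E `` {k}. of_bool (card (descendants E c) = Suc j))"
      by (rule sum.swap)
    finally show "of_bool (Max (heavy_nodes n E) = k) = (\<Sum>j = ?h..<n. of_bool (card (descendants E k) = Suc j) -
        (\<Sum>c\<in>E `` {k}. of_bool (card (descendants E c) = Suc j)) :: real)"
      unfolding centroid_indicator[OF E n(3)] hv[OF E n(3)] sum_subtractf by simp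
  qed
  also have "\<dots> = (\<Sum>j = ?h..<n. (polya \<alpha> (real k - 1) m j - \<alpha> * polya_child \<alpha> k m j) / ?p)"
    unfolding edge_mean_sum edge_mean_diff unfolding n(1)
    unfolding mean_subtree_size[OF assms(1)] mean_child_sizes[OF assms(1)]
    by (simp add: diff_divide_distrib add.commute)
  also have "\<dots> = (\<Sum>j = ?h..<n. polya \<alpha> k m j - polya \<alpha> k m (Suc j)) / ?p - correction_term n k"
    unfolding polya_telescope correction_term_def m_def[symmetric]
    by (simp add: sum_subtractf diff_divide_distrib sum_divide_distrib)
  also have "(\<Sum>j = ?h..<n. polya \<alpha> k m j - polya \<alpha> k m (Suc j)) = polya \<alpha> k m ?h"
    using assms(1) by (intro sum_telescope_to_0 polya_eq_0) (auto simp: n(1))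
  finally show ?thesis by (simp add: boundary_term_def m_def)
qed

lemma correction_term_step:
  assumes "1 \<le> k" "k < n"
  shows "correction_term n k - correction_term n (Suc k) = boundary_term n (Suc k) / (\<alpha> + k - 1)"
proof -
  define m where "m = n - Suc k"
  have m: "n - k = Suc m" using assms by (simp add: m_def)
  let ?s = "\<alpha> + real k - 1" and ?h = "n div 2"
  let ?p = "pochhammer (\<alpha> + real k) m"
  have s: "?s \<noteq> 0" using alpha_pos assms by simp
  have p: "?p \<noteq> 0" using alpha_pos pochhammer_pos[of "\<alpha> + real k" m] by simp
  have "correction_term n k = (\<Sum>j = ?h..<n. polya_child \<alpha> k (Suc m) j) / (?s * ?p)"
    unfolding correction_term_def m by (simp add: pochhammer_rec)
  moreover have "correction_term n (Suc k) = (\<Sum>j = ?h..<n. ?s * polya_child \<alpha> (real k + 1) m j) / (?s * ?p)"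
    unfolding correction_term_def m_def[symmetric] using s by (simp add: add.commute flip: sum_distrib_left)
  ultimately have "correction_term n k - correction_term n (Suc k) =
      (\<Sum>j = ?h..<n. polya \<alpha> (real k + 1) m j - polya \<alpha> (real k + 1) m (Suc j)) / (?s * ?p)"
    unfolding polya_child_shift[symmetric] sum_subtractf diff_divide_distrib by simp
  also have "(\<Sum>j = ?h..<n. polya \<alpha> (real k + 1) m j - polya \<alpha> (real k + 1) m (Suc j)) =
      polya \<alpha> (real k + 1) m ?h"
    using assms by (intro sum_telescope_to_0 polya_eq_0) (auto simp: m_def)
  finally show ?thesis
    unfolding boundary_term_def m_def[symmetric] by (simp add: add.commute)
qed

text \<open>
  The differences of consecutive correction terms are boundary values, and for \<open>k = n\<close> the correction
  vanishes because the last node has no children. So all probabilities are expressed by boundary values.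
\<close>

lemma correction_term_eq_sum:
  assumes "1 \<le> k" "k \<le> n"
  shows "correction_term n k = (\<Sum>l = k..<n. boundary_term n (Suc l) / (\<alpha> + l - 1))"
proof -
  have "correction_term n n = 0" by (simp add: correction_term_def polya_child_def)
  then have "correction_term n k = (\<Sum>l = k..<n. correction_term n l - correction_term n (Suc l))"
    by (rule sum_telescope_to_0[OF assms(2), symmetric])
  also have "\<dots> = (\<Sum>l = k..<n. boundary_term n (Suc l) / (\<alpha> + l - 1))"
    using assms(1) by (intro sum.cong correction_term_step) auto
  finally show ?thesis .
qed

text \<open>
  In this form the dependence on \<open>n\<close> is confined to two quotients with evident limits and bounds. For
  \<open>i > n - 1 - n div 2\<close> both sides are zero.
\<close>

lemma boundary_term_closed_form:
  assumes "i < n"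
  shows "boundary_term n (Suc i) = rising_coeff \<alpha> i * (rising_coeff \<alpha> (n div 2) / rising_coeff \<alpha> (n - 1)) *
    (real ((n - 1 - n div 2) choose i) / real ((n - 1) choose i))"
proof (cases "n div 2 \<le> n - Suc i")
  case False
  then have "n - 1 - n div 2 < i" using assms by linarith
  then show ?thesis using False by (simp add: boundary_term_def polya_def binomial_eq_0)
next
  case True
  define h where "h = n div 2"
  define m where "m = n - Suc i"
  define r where "r = m - h"
  have n1: "n - 1 = i + m" "i + m - h = i + r" "m = h + r" using True assms by (auto simp: h_def m_def r_def)
  have e: "real (Suc i) = 1 + real i" by simp
  have f: "fact (i + r) = fact i * pochhammer (real (Suc i)) r"
    using pochhammer_product'[of "1::real" i r] unfolding e by (simp add: pochhammer_fact)
  have p: "pochhammer \<alpha> (i + m) = pochhammer \<alpha> i * pochhammer (\<alpha> + i) m"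
    by (rule pochhammer_product')
  have c: "real (m choose h) = fact m / (fact h * fact r)"
    "real ((i + r) choose i) = fact (i + r) / (fact i * fact r)"
    "real ((i + m) choose i) = fact (i + m) / (fact i * fact m)"
    using binomial_fact[of h m, where 'a = real] binomial_fact[of i "i + r", where 'a = real]
      binomial_fact[of i "i + m", where 'a = real] n1(3) by simp_all
  have pos: "pochhammer \<alpha> i \<noteq> 0" "pochhammer (\<alpha> + i) m \<noteq> 0"
    using alpha_pos pochhammer_pos[of \<alpha> i] pochhammer_pos[of "\<alpha> + i" m] by simp_all
  have "boundary_term n (Suc i) = real (m choose h) * pochhammer \<alpha> h * pochhammer (real (Suc i)) r /
      pochhammer (\<alpha> + i) m"
    unfolding boundary_term_def polya_def h_def[symmetric] m_def[symmetric] r_def[symmetric] by simp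
  then show ?thesis
    unfolding rising_coeff_def h_def[symmetric] n1(1,2) c p f using pos by (simp add: field_simps)
qed

end

section \<open>Asymptotics of the boundary terms\<close>

lemma half_over_pred: "(\<lambda>n. real (n div 2) / real (n - 1)) \<longlonglongrightarrow> 1 / 2"
proof (rule tendsto_sandwich)
  show "eventually (\<lambda>n. (real n / 2 - 1) / (real n - 1) \<le> real (n div 2) / real (n - 1)) sequentially"
    using eventually_gt_at_top[of 1]
  proof eventually_elim
    case (elim n)
    then have "real n / 2 - 1 \<le> real (n div 2)" by linarith
    then show ?case using elim by (simp add: of_nat_diff divide_right_mono)
  qed
  show "eventually (\<lambda>n. real (n div 2) / real (n - 1) \<le> (real n / 2) / (real n - 1)) sequentially"
    using eventually_gt_at_top[of 1]
  proof eventually_elim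
    case (elim n)
    have "real (n div 2) \<le> real n / 2" by linarith
    then show ?case using elim by (simp add: of_nat_diff divide_right_mono del: divide_divide_eq_left)
  qed
qed real_asymp+

text \<open>
  The coefficient of index \<open>s\<close> grows like \<open>s powr (\<alpha> - 1) / Gamma \<alpha>\<close>, and \<open>n div 2\<close> is about half of
  \<open>n - 1\<close>.
\<close>

lemma rising_coeff_ratio:
  assumes "\<alpha> > 0"
  shows "(\<lambda>n. rising_coeff \<alpha> (n div 2) / rising_coeff \<alpha> (n - 1)) \<longlonglongrightarrow> 2 powr (1 - \<alpha>)"
proof -
  have h: "filterlim (\<lambda>n::nat. n div 2) at_top at_top"
    by (rule filterlim_at_top_div_const_nat) simp
  have p: "filterlim (\<lambda>n::nat. n - 1) at_top at_top" by (rule filterlim_minus_const_nat_at_top)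
  have G: "Gamma_series' \<alpha> \<longlonglongrightarrow> Gamma \<alpha>" by (rule Gamma_series'_LIMSEQ)
  \<comment> \<open>The sequence \<open>Gamma_series'\<close> is Euler's limit formula for the Gamma function.\<close>
  have gs: "rising_coeff \<alpha> s = real s powr (\<alpha> - 1) / Gamma_series' \<alpha> s" if "s > 0" for s
  proof -
    have "(fact s :: real) = s * fact (s - 1)" using that by (simp add: fact_reduce)
    moreover have "real s powr \<alpha> = exp (\<alpha> * ln s)" using that by (simp add: powr_def)
    moreover have "real s powr (\<alpha> - 1) = real s powr \<alpha> / s" using that by (simp add: powr_diff)
    ultimately show ?thesis by (simp add: rising_coeff_def Gamma_series'_def)
  qed
  have "(\<lambda>n. (real (n div 2) / real (n - 1)) powr (\<alpha> - 1) *
      (Gamma_series' \<alpha> (n - 1) / Gamma_series' \<alpha> (n div 2))) \<longlonglongrightarrow> (1 / 2) powr (\<alpha> - 1) * (Gamma \<alpha> / Gamma \<alpha>)"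
    using Gamma_real_pos[OF assms]
    by (intro tendsto_intros half_over_pred filterlim_compose[OF G h] filterlim_compose[OF G p]) auto
  also have "(1 / 2) powr (\<alpha> - 1) * (Gamma \<alpha> / Gamma \<alpha>) = 2 powr (1 - \<alpha>)"
    using Gamma_real_pos[OF assms] by (simp add: powr_divide powr_diff)
  finally show ?thesis
  proof (rule Lim_transform_eventually)
    show "eventually (\<lambda>n. (real (n div 2) / real (n - 1)) powr (\<alpha> - 1) *
        (Gamma_series' \<alpha> (n - 1) / Gamma_series' \<alpha> (n div 2)) =
        rising_coeff \<alpha> (n div 2) / rising_coeff \<alpha> (n - 1)) sequentially"
      using eventually_gt_at_top[of 1]
    proof eventually_elim
      case (elim n)
      then have "n div 2 > 0" "n - 1 > 0" by auto
      then show ?case by (simp only: gs powr_divide of_nat_0_le_iff) (simp add: field_simps)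
    qed
  qed
qed

lemma rising_coeff_pos: "\<alpha> > 0 \<Longrightarrow> rising_coeff \<alpha> i > 0"
  by (simp add: rising_coeff_def pochhammer_pos)

lemma rising_coeff_Suc: "rising_coeff \<alpha> (Suc i) = rising_coeff \<alpha> i * (\<alpha> + i) / (real i + 1)"
  by (simp add: rising_coeff_def pochhammer_Suc field_simps)

lemma rising_coeff_le:
  assumes "\<alpha> > 0" "\<alpha> \<le> 2" shows "rising_coeff \<alpha> i \<le> real i + 1"
proof (induction i)
  case (Suc i)
  have "rising_coeff \<alpha> (Suc i) \<le> (real i + 1) * (\<alpha> + i) / (real i + 1)"
    unfolding rising_coeff_Suc using Suc assms by (intro divide_right_mono mult_right_mono) auto
  also have "\<dots> = \<alpha> + i" by simp
  finally show ?case using assms by simp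
qed (simp add: rising_coeff_def)

lemma choose_ratio_Suc:
  assumes "i < N"
  shows "real (M choose Suc i) / real (N choose Suc i) =
    real (M choose i) / real (N choose i) * ((real M - i) / (real N - i))"
proof -
  have "real (M choose Suc i) = real (M choose i) * (real M - i) / Suc i"
    "real (N choose Suc i) = real (N choose i) * (real N - i) / Suc i"
    by (simp_all add: choose_Suc_mult)
  then show ?thesis by simp
qed

text \<open>
  Successive quotients are at most one half, because \<open>M - i \<le> (N - i) / 2\<close>.
\<close>

lemma choose_ratio_le:
  assumes "2 * M \<le> N" "i \<le> N"
  shows "real (M choose i) / real (N choose i) \<le> (1 / 2) ^ i"
  using assms(2)
proof (induction i)
  case (Suc i)
  show ?case
  proof (cases "i < M")
    case True
    have "(real M - i) / (real N - i) \<le> 1 / 2" using Suc.prems assms(1) by (simp add: field_simps)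
    then have "real (M choose i) / real (N choose i) * ((real M - i) / (real N - i)) \<le> (1 / 2) ^ i * (1 / 2)"
      using Suc True by (intro mult_mono) auto
    then show ?thesis using Suc.prems by (simp add: choose_ratio_Suc)
  qed (simp add: binomial_eq_0)
qed simp

lemma choose_ratio_lim:
  "(\<lambda>n. real ((n - 1 - n div 2) choose i) / real ((n - 1) choose i)) \<longlonglongrightarrow> (1 / 2) ^ i"
proof (induction i)
  case (Suc i)
  have lim: "(\<lambda>n. (real (n - 1 - n div 2) - i) / (real (n - 1) - i)) \<longlonglongrightarrow> 1 / 2"
  proof (rule tendsto_sandwich)
    show "eventually (\<lambda>n. (real n / 2 - 1 - i) / (real n - 1 - i) \<le>
        (real (n - 1 - n div 2) - i) / (real (n - 1) - i)) sequentially"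
      using eventually_gt_at_top[of "i + 1"]
    proof eventually_elim
      case (elim n)
      then have "real n / 2 - 1 \<le> real (n - 1 - n div 2)" "real (n - 1) = real n - 1" by linarith+
      then show ?case using elim by (simp add: divide_right_mono)
    qed
    show "eventually (\<lambda>n. (real (n - 1 - n div 2) - i) / (real (n - 1) - i) \<le>
        (real n / 2 - i) / (real n - 1 - i)) sequentially"
      using eventually_gt_at_top[of "i + 1"]
    proof eventually_elim
      case (elim n)
      then have "real (n - 1 - n div 2) \<le> real n / 2" "real (n - 1) = real n - 1" by linarith+
      then show ?case using elim by (simp add: divide_right_mono)
    qed
  qed real_asymp+
  have "(\<lambda>n. real ((n - 1 - n div 2) choose i) / real ((n - 1) choose i) *
      ((real (n - 1 - n div 2) - i) / (real (n - 1) - i))) \<longlonglongrightarrow> (1 / 2) ^ i * (1 / 2)"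
    by (intro tendsto_mult Suc.IH lim)
  then have "(\<lambda>n. real ((n - 1 - n div 2) choose Suc i) / real ((n - 1) choose Suc i)) \<longlonglongrightarrow> (1 / 2) ^ i * (1 / 2)"
  proof (rule Lim_transform_eventually)
    show "eventually (\<lambda>n. real ((n - 1 - n div 2) choose i) / real ((n - 1) choose i) *
        ((real (n - 1 - n div 2) - i) / (real (n - 1) - i)) =
        real ((n - 1 - n div 2) choose Suc i) / real ((n - 1) choose Suc i)) sequentially"
      using eventually_gt_at_top[of "i + 1"]
      by eventually_elim (simp add: choose_ratio_Suc)
  qed
  then show ?case by (simp add: mult.commute)
qed simp

lemma summable_poly_geometric: "summable (\<lambda>k. (real k + 1) ^ p * (1 / 2) ^ k)"
proof (rule summable_comparison_test_bigo)
  show "summable (\<lambda>k. norm ((3 / 4 :: real) ^ k))" by (simp add: summable_geometric)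
  show "(\<lambda>k. (real k + 1) ^ p * (1 / 2) ^ k) \<in> O(\<lambda>k. (3 / 4) ^ k)" by real_asymp
qed

lemma tannery:
  fixes a :: "nat \<Rightarrow> nat \<Rightarrow> real"
  assumes "\<And>k. (\<lambda>n. a k n) \<longlonglongrightarrow> b k" "\<And>k n. \<bar>a k n\<bar> \<le> M k" "summable M"
  shows "(\<lambda>n. \<Sum>k. a k n) \<longlonglongrightarrow> (\<Sum>k. b k)"
proof -
  have "eventually (\<lambda>(k, n). norm (a k n) \<le> M k) (at_top \<times>\<^sub>F sequentially)"
    using assms(2) by (intro always_eventually) auto
  from tannerys_theorem[OF assms(1) this assms(3)] show ?thesis by simp
qed

section \<open>The limit distribution as a series\<close>

text \<open>
  Integrate the derivative of \<open>t ^ (n + 1) * (1 - t) powr (\<alpha> - 1)\<close> over the interval from \<open>0\<close> to \<open>1 / 2\<close>.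
\<close>

lemma half_int_step:
  "(\<alpha> + n) * half_int \<alpha> (Suc n) = (n + 1) * half_int \<alpha> n - 2 powr (- (\<alpha> + n))"
proof -
  let ?F = "\<lambda>t::real. t ^ Suc n * (1 - t) powr (\<alpha> - 1)"
  have "((\<lambda>t. real (Suc n) * (t ^ n * (1 - t) powr (\<alpha> - 2)) - (\<alpha> + n) * (t ^ Suc n * (1 - t) powr (\<alpha> - 2)))
      has_integral ?F (1/2) - ?F 0) {0..1/2}"
  proof (rule fundamental_theorem_of_calculus)
    fix t :: real assume t: "t \<in> {0..1/2}"
    have "(1 - t) powr (\<alpha> - 1) = (1 - t) powr (1 + (\<alpha> - 2))" by simp
    also have "\<dots> = (1 - t) * (1 - t) powr (\<alpha> - 2)" using t by (subst powr_add) auto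
    finally have p: "(1 - t) powr (\<alpha> - 1) = (1 - t) * (1 - t) powr (\<alpha> - 2)" .
    have "(?F has_real_derivative
        real (Suc n) * t ^ n * (1 - t) powr (\<alpha> - 1) - t ^ Suc n * ((\<alpha> - 1) * (1 - t) powr (\<alpha> - 2)))
        (at t within {0..1/2})"
      using t by (auto intro!: derivative_eq_intros simp del: power_Suc)
    also have "real (Suc n) * t ^ n * (1 - t) powr (\<alpha> - 1) - t ^ Suc n * ((\<alpha> - 1) * (1 - t) powr (\<alpha> - 2)) =
        real (Suc n) * (t ^ n * (1 - t) powr (\<alpha> - 2)) - (\<alpha> + n) * (t ^ Suc n * (1 - t) powr (\<alpha> - 2))"
      unfolding p by (simp add: algebra_simps)
    finally show "(?F has_vector_derivative real (Suc n) * (t ^ n * (1 - t) powr (\<alpha> - 2)) -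
        (\<alpha> + n) * (t ^ Suc n * (1 - t) powr (\<alpha> - 2))) (at t within {0..1/2})"
      by (simp add: has_real_derivative_iff_has_vector_derivative)
  qed simp
  moreover have "((\<lambda>t. real (Suc n) * (t ^ n * (1 - t) powr (\<alpha> - 2)) - (\<alpha> + n) * (t ^ Suc n * (1 - t) powr (\<alpha> - 2)))
      has_integral real (Suc n) * half_int \<alpha> n - (\<alpha> + n) * half_int \<alpha> (Suc n)) {0..1/2}"
    by (intro has_integral_diff has_integral_mult_right half_int_has_integral)
  ultimately have "real (Suc n) * half_int \<alpha> n - (\<alpha> + n) * half_int \<alpha> (Suc n) = ?F (1/2) - ?F 0"
    using has_integral_unique by blast
  also have "\<dots> = 2 powr (- (\<alpha> + n))"
  proof -
    have "(1/2::real) ^ Suc n * (1/2) powr (\<alpha> - 1) = (1/2) powr real (Suc n) * (1/2) powr (\<alpha> - 1)"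
      by (subst powr_realpow) auto
    also have "\<dots> = (1/2) powr (\<alpha> + real n)" by (simp add: algebra_simps flip: powr_add)
    also have "\<dots> = 2 powr (- (\<alpha> + real n))" by (simp add: powr_divide powr_minus_divide[symmetric])
    finally show ?thesis by simp
  qed
  finally show ?thesis by (simp add: algebra_simps)
qed

text \<open>
  The limit of the boundary term for the label \<open>i + 1\<close>.
\<close>

definition boundary_limit :: "real \<Rightarrow> nat \<Rightarrow> real" where
  "boundary_limit \<alpha> i = rising_coeff \<alpha> i * 2 powr (1 - \<alpha>) * (1 / 2) ^ i"

lemma boundary_limit_alt: "boundary_limit \<alpha> i = rising_coeff \<alpha> i * (2 * 2 powr (- (\<alpha> + i)))"
  by (simp add: boundary_limit_def powr_diff powr_minus powr_add powr_realpow field_simps)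

text \<open>
  By the recurrence for \<open>half_int\<close>, consecutive values of \<open>rising_coeff \<alpha> i * half_int \<alpha> i\<close> differ by the
  terms of this series. These values tend to zero, so the series sums to the value at \<open>i\<close>.
\<close>

lemma limit_prob_series:
  assumes "\<alpha> > 0" "\<alpha> \<le> 2"
  shows "limit_prob \<alpha> (Suc i) = boundary_limit \<alpha> i - (\<Sum>j. boundary_limit \<alpha> (Suc (i + j)) / (\<alpha> + (i + j)))"
proof -
  let ?f = "\<lambda>n. rising_coeff \<alpha> n * half_int \<alpha> n"
  have step: "?f n - ?f (Suc n) = boundary_limit \<alpha> (Suc n) / (\<alpha> + n)" for n
  proof -
    have "?f (Suc n) = rising_coeff \<alpha> n * ((\<alpha> + n) * half_int \<alpha> (Suc n)) / (real n + 1)"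
      by (simp add: rising_coeff_Suc)
    also have "\<dots> = ?f n - rising_coeff \<alpha> n * 2 powr (- (\<alpha> + n)) / (real n + 1)"
      unfolding half_int_step by (simp add: field_simps)
    also have "rising_coeff \<alpha> n * 2 powr (- (\<alpha> + n)) / (real n + 1) = boundary_limit \<alpha> (Suc n) / (\<alpha> + n)"
    proof -
      have "2 * 2 powr (- (\<alpha> + real (Suc n))) = 2 powr (- (\<alpha> + n))"
        by (simp add: powr_diff powr_minus powr_add field_simps)
      then show ?thesis using assms(1) by (simp add: boundary_limit_alt rising_coeff_Suc)
    qed
    finally show ?thesis by simp
  qed
  have "?f \<longlonglongrightarrow> 0"
  proof (rule tendsto_sandwich[of "\<lambda>_. 0" _ _ "\<lambda>n. 2 powr (1 - \<alpha>) * (1 / 2) ^ n"])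
    show "eventually (\<lambda>n. ?f n \<le> 2 powr (1 - \<alpha>) * (1 / 2) ^ n) sequentially"
    proof (intro always_eventually allI)
      fix n
      have "?f n \<le> real (Suc n) * (2 * 2 powr (- (\<alpha> + n)) / Suc n)"
        using rising_coeff_le[OF assms, of n] rising_coeff_pos[OF assms(1), of n]
          half_int_le[OF assms(2), of n] half_int_nonneg
        by (intro mult_mono) auto
      also have "\<dots> = 2 * 2 powr (- (\<alpha> + n))" by (simp del: of_nat_Suc)
      also have "\<dots> = 2 powr (1 - \<alpha>) * (1 / 2) ^ n"
        by (simp add: powr_diff powr_minus powr_add powr_realpow field_simps)
      finally show "?f n \<le> 2 powr (1 - \<alpha>) * (1 / 2) ^ n" .
    qed
    show "eventually (\<lambda>n. 0 \<le> ?f n) sequentially"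
      using rising_coeff_pos[OF assms(1)] half_int_nonneg
      by (intro always_eventually allI mult_nonneg_nonneg) (simp_all add: less_imp_le)
    show "(\<lambda>n. 2 powr (1 - \<alpha>) * (1 / 2 :: real) ^ n) \<longlonglongrightarrow> 0"
      by (intro tendsto_mult_right_zero LIMSEQ_realpow_zero) auto
  qed simp
  then have "(\<lambda>j. ?f (j + i)) \<longlonglongrightarrow> 0" by (rule LIMSEQ_ignore_initial_segment)
  from telescope_sums'[OF this] have "(\<lambda>j. boundary_limit \<alpha> (Suc (i + j)) / (\<alpha> + (i + j))) sums ?f i"
    using step[of "_ + i"] by (simp add: add_ac)
  then have "(\<Sum>j. boundary_limit \<alpha> (Suc (i + j)) / (\<alpha> + (i + j))) = ?f i" by (rule sums_unique[symmetric])
  then show ?thesis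
    unfolding limit_prob_Suc[OF assms(1)] gchoose_shift boundary_limit_alt
    by (simp add: rising_coeff_def right_diff_distrib)
qed

section \<open>Convergence of the moments\<close>

context very_simple_family
begin

text \<open>
  Indices start at \<open>0\<close> and values beyond the label \<open>n\<close> are zero, so that finite sums over labels become
  series over all natural numbers.
\<close>

definition boundary_term0 :: "nat \<Rightarrow> nat \<Rightarrow> real" where
  "boundary_term0 n i = (if i < n then boundary_term n (Suc i) else 0)"

lemma boundary_term0_lim: "(\<lambda>n. boundary_term0 n i) \<longlonglongrightarrow> boundary_limit \<alpha> i"
proof -
  have "(\<lambda>n. rising_coeff \<alpha> i * (rising_coeff \<alpha> (n div 2) / rising_coeff \<alpha> (n - 1)) *
      (real ((n - 1 - n div 2) choose i) / real ((n - 1) choose i))) \<longlonglongrightarrow> boundary_limit \<alpha> i"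
    unfolding boundary_limit_def by (intro tendsto_intros rising_coeff_ratio choose_ratio_lim alpha_pos)
  then show ?thesis
  proof (rule Lim_transform_eventually)
    show "eventually (\<lambda>n. rising_coeff \<alpha> i * (rising_coeff \<alpha> (n div 2) / rising_coeff \<alpha> (n - 1)) *
      (real ((n - 1 - n div 2) choose i) / real ((n - 1) choose i)) = boundary_term0 n i) sequentially"
      using eventually_gt_at_top[of i] by eventually_elim (simp add: boundary_term0_def boundary_term_closed_form)
  qed
qed

text \<open>
  A bound that does not depend on \<open>n\<close>. It provides the summable majorants for both applications of
  Tannery's theorem, and is the reason why all moments converge.
\<close>

lemma boundary_term0_bound:
  obtains B where "B \<ge> 0" "\<And>n i. 0 \<le> boundary_term0 n i" "\<And>n i. boundary_term0 n i \<le> B * ((real i + 1) * (1 / 2) ^ i)"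
proof -
  let ?r = "\<lambda>n. rising_coeff \<alpha> (n div 2) / rising_coeff \<alpha> (n - 1)"
  have "Bseq ?r" using rising_coeff_ratio[OF alpha_pos] convergentI convergent_imp_Bseq by blast
  then obtain B where B: "B > 0" "\<And>n. norm (?r n) \<le> B" by (auto elim: BseqE)
  have r: "0 \<le> ?r n" "?r n \<le> B" for n
    using rising_coeff_pos[OF alpha_pos] B(2)[of n] by (auto simp: less_imp_le)
  have b: "0 \<le> boundary_term0 n i \<and> boundary_term0 n i \<le> B * ((real i + 1) * (1 / 2) ^ i)" for n i
  proof (cases "i < n")
    case True
    let ?c = "rising_coeff \<alpha> i" and ?q = "real ((n - 1 - n div 2) choose i) / real ((n - 1) choose i)"
    have q: "?q \<le> (1 / 2) ^ i" using True by (intro choose_ratio_le) auto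
    have c: "0 \<le> ?c" "?c \<le> real i + 1"
      using rising_coeff_pos[OF alpha_pos, of i] rising_coeff_le[OF alpha_pos alpha_le, of i] by auto
    have h: "boundary_term0 n i = ?c * ?r n * ?q" using True by (simp only: boundary_term0_def if_True boundary_term_closed_form)
    have "?c * ?r n * ?q \<le> (real i + 1) * B * (1 / 2) ^ i"
      using c r[of n] q B(1) by (intro mult_mono mult_nonneg_nonneg) auto
    moreover have "0 \<le> ?c * ?r n * ?q" using c(1) r(1)[of n] by (intro mult_nonneg_nonneg) auto
    ultimately show ?thesis unfolding h by (simp add: mult_ac)
  qed (use B(1) in \<open>simp add: boundary_term0_def\<close>)
  show ?thesis using that[of B] B(1) b by simp
qed

definition centroid_prob0 :: "nat \<Rightarrow> nat \<Rightarrow> real" where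
  "centroid_prob0 n i = (if i < n then centroid_prob n (Suc i) else 0)"

lemma centroid_prob0_eq:
  "i < n \<Longrightarrow> centroid_prob0 n i = boundary_term0 n i - (\<Sum>j. boundary_term0 n (Suc (i + j)) / (\<alpha> + (i + j)))"
proof -
  assume i: "i < n"
  have "correction_term n (Suc i) = (\<Sum>l = Suc i..<n. boundary_term n (Suc l) / (\<alpha> + l - 1))"
    using i by (intro correction_term_eq_sum) auto
  also have "\<dots> = (\<Sum>j<n - Suc i. boundary_term n (Suc (Suc i + j)) / (\<alpha> + real (Suc i + j) - 1))"
    by (subst sum.atLeastLessThan_shift_0) (simp add: atLeast0LessThan)
  also have "\<dots> = (\<Sum>j<n - Suc i. boundary_term0 n (Suc (i + j)) / (\<alpha> + (i + j)))"
    by (intro sum.cong) (auto simp: boundary_term0_def)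
  also have "\<dots> = (\<Sum>j. boundary_term0 n (Suc (i + j)) / (\<alpha> + (i + j)))"
    by (rule suminf_finite[symmetric]) (auto simp: boundary_term0_def)
  finally show ?thesis using i by (simp add: centroid_prob0_def centroid_prob_eq boundary_term0_def)
qed

text \<open>
  First application of Tannery's theorem, to the series of correction terms.
\<close>

lemma centroid_prob0_lim: "(\<lambda>n. centroid_prob0 n i) \<longlonglongrightarrow> limit_prob \<alpha> (Suc i)"
proof -
  obtain B where B: "B \<ge> 0" "\<And>n i. 0 \<le> boundary_term0 n i" "\<And>n i. boundary_term0 n i \<le> B * ((real i + 1) * (1 / 2) ^ i)"
    by (rule boundary_term0_bound) blast
  let ?g = "\<lambda>k. (real k + 1) * (1 / 2 :: real) ^ k"
  have "(\<lambda>n. \<Sum>j. boundary_term0 n (Suc (i + j)) / (\<alpha> + (i + j))) \<longlonglongrightarrow>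
      (\<Sum>j. boundary_limit \<alpha> (Suc (i + j)) / (\<alpha> + (i + j)))"
  proof (rule tannery)
    show "(\<lambda>n. boundary_term0 n (Suc (i + j)) / (\<alpha> + (i + j))) \<longlonglongrightarrow> boundary_limit \<alpha> (Suc (i + j)) / (\<alpha> + (i + j))" for j
      using alpha_pos by (intro tendsto_intros boundary_term0_lim) auto
    show "\<bar>boundary_term0 n (Suc (i + j)) / (\<alpha> + (i + j))\<bar> \<le> B / \<alpha> * ?g (j + Suc i)" for j n
    proof -
      have "boundary_term0 n (Suc (i + j)) / (\<alpha> + (i + j)) \<le> B * ?g (Suc (i + j)) / \<alpha>"
        using B(1) B(2)[of n "Suc (i + j)"] B(3)[of n "Suc (i + j)"] alpha_pos by (intro frac_le) auto
      moreover have "0 \<le> boundary_term0 n (Suc (i + j)) / (\<alpha> + (i + j))"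
        using B(2)[of n "Suc (i + j)"] alpha_pos by (intro divide_nonneg_nonneg) auto
      moreover have "Suc (i + j) = j + Suc i" by simp
      ultimately show ?thesis by (simp only: abs_of_nonneg times_divide_eq_left)
    qed
    show "summable (\<lambda>j. B / \<alpha> * ?g (j + Suc i))"
      using summable_poly_geometric[of 1] by (intro summable_mult summable_ignore_initial_segment) simp
  qed
  then have "(\<lambda>n. boundary_term0 n i - (\<Sum>j. boundary_term0 n (Suc (i + j)) / (\<alpha> + (i + j)))) \<longlonglongrightarrow> limit_prob \<alpha> (Suc i)"
    unfolding limit_prob_series[OF alpha_pos alpha_le] by (intro tendsto_diff boundary_term0_lim)
  then show ?thesis
    by (rule Lim_transform_eventually)
       (use eventually_gt_at_top[of i] in \<open>eventually_elim, simp add: centroid_prob0_eq\<close>)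
qed

lemma centroid_prob0_bounds:
  shows "0 \<le> centroid_prob0 n i" "centroid_prob0 n i \<le> boundary_term0 n i"
proof -
  have "0 \<le> centroid_prob0 n i \<and> centroid_prob0 n i \<le> boundary_term0 n i"
  proof (cases "i < n")
    case True
    have "0 \<le> centroid_prob n (Suc i)"
      unfolding centroid_prob_def using True by (intro edge_mean_nonneg) auto
    moreover have "0 \<le> correction_term n (Suc i)"
      unfolding correction_term_def polya_child_def using alpha_pos
      by (intro divide_nonneg_nonneg sum_nonneg mult_nonneg_nonneg pochhammer_nonneg) auto
    ultimately show ?thesis using True by (simp add: centroid_prob0_def boundary_term0_def centroid_prob_eq)
  qed (simp add: centroid_prob0_def boundary_term0_def)
  then show "0 \<le> centroid_prob0 n i" "centroid_prob0 n i \<le> boundary_term0 n i" by auto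
qed

lemma centroid_moment:
  assumes "n \<ge> 1"
  shows "measure_pmf.expectation (random_tree c1 c2 n) (\<lambda>T. real (centroid_label T) ^ m) =
    (\<Sum>i. real (Suc i) ^ m * centroid_prob0 n i)"
proof -
  have "measure_pmf.expectation (random_tree c1 c2 n) (\<lambda>T. real (centroid_label T) ^ m) =
      edge_mean n (\<lambda>E. real (Max (heavy_nodes n E)) ^ m)"
    by (rule expectation_edges[OF assms]) (simp add: centroid_label_eq[OF _ assms])
  also have "\<dots> = edge_mean n (\<lambda>E. \<Sum>k = 1..n. real k ^ m * of_bool (Max (heavy_nodes n E) = k))"
  proof (rule edge_mean_cong[OF assms])
    fix E assume "recursive_tree n E"
    then have "Max (heavy_nodes n E) \<in> {1..n}" by (rule heavy_nodes_eq_ancestors(1))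
    then show "real (Max (heavy_nodes n E)) ^ m = (\<Sum>k = 1..n. real k ^ m * of_bool (Max (heavy_nodes n E) = k))"
      by (simp add: of_bool_def if_distrib[of "\<lambda>a. _ * a"] cong: if_cong)
  qed
  also have "\<dots> = (\<Sum>k = 1..n. real k ^ m * centroid_prob n k)"
    unfolding edge_mean_sum edge_mean_mult centroid_prob_def ..
  also have "\<dots> = (\<Sum>i<n. real (Suc i) ^ m * centroid_prob n (Suc i))"
    using sum.shift_bounds_cl_Suc_ivl[of "\<lambda>k. real k ^ m * centroid_prob n k" 0 "n - 1"] assms
    by (simp add: atLeast0AtMost lessThan_Suc_atMost[symmetric])
  also have "\<dots> = (\<Sum>i<n. real (Suc i) ^ m * centroid_prob0 n i)"
    by (simp add: centroid_prob0_def)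
  also have "\<dots> = (\<Sum>i. real (Suc i) ^ m * centroid_prob0 n i)"
    by (rule suminf_finite[symmetric]) (auto simp: centroid_prob0_def)
  finally show ?thesis .
qed

lemma limit_moment:
  assumes "summable (\<lambda>i. real (Suc i) ^ m * limit_prob \<alpha> (Suc i))"
  shows "integrable (measure_pmf (limit_label \<alpha>)) (\<lambda>k. real k ^ m)"
    and "measure_pmf.expectation (limit_label \<alpha>) (\<lambda>k. real k ^ m) =
      (\<Sum>i. real (Suc i) ^ m * limit_prob \<alpha> (Suc i))"
proof -
  let ?p = "pmf (limit_label \<alpha>)"
  let ?g = "\<lambda>k. ?p k * real k ^ m"
  have sums: "(\<lambda>i. ?g (Suc i)) sums (\<Sum>i. real (Suc i) ^ m * limit_prob \<alpha> (Suc i))"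
    using summable_sums[OF assms] by (simp add: pmf_limit_label[OF very_simple] mult.commute)
  have s: "?g sums (\<Sum>i. real (Suc i) ^ m * limit_prob \<alpha> (Suc i))"
  proof -
    have "?g 0 = 0" by (simp add: pmf_limit_label[OF very_simple])
    have "?g sums ((\<Sum>i. real (Suc i) ^ m * limit_prob \<alpha> (Suc i)) + ?g 0)"
      using sums by (rule iffD1[OF sums_Suc_iff[of ?g]])
    then show ?thesis using \<open>?g 0 = 0\<close> by (simp only: add_0_right)
  qed
  then have int: "integrable (count_space UNIV) ?g"
    unfolding integrable_count_space_nat_iff by (simp add: sums_iff)
  then show "integrable (measure_pmf (limit_label \<alpha>)) (\<lambda>k. real k ^ m)"
    unfolding measure_pmf_eq_density by (subst integrable_density) auto
  have "measure_pmf.expectation (limit_label \<alpha>) (\<lambda>k. real k ^ m) = (\<integral>k. ?g k \<partial>count_space UNIV)"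
    unfolding measure_pmf_eq_density by (subst integral_density) auto
  also have "\<dots> = (\<Sum>i. real (Suc i) ^ m * limit_prob \<alpha> (Suc i))"
    using int s by (subst integral_count_space_nat) (simp_all add: sums_iff)
  finally show "measure_pmf.expectation (limit_label \<alpha>) (\<lambda>k. real k ^ m) =
      (\<Sum>i. real (Suc i) ^ m * limit_prob \<alpha> (Suc i))" .
qed

text \<open>
  Second application of Tannery's theorem, now to the series over all labels.
\<close>

lemma centroid_moment_lim:
  shows "summable (\<lambda>i. real (Suc i) ^ m * limit_prob \<alpha> (Suc i))"
    and "(\<lambda>n. \<Sum>i. real (Suc i) ^ m * centroid_prob0 n i) \<longlonglongrightarrow>
      (\<Sum>i. real (Suc i) ^ m * limit_prob \<alpha> (Suc i))"
proof -
  obtain B where B: "B \<ge> 0" "\<And>n i. 0 \<le> boundary_term0 n i" "\<And>n i. boundary_term0 n i \<le> B * ((real i + 1) * (1 / 2) ^ i)"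
    by (rule boundary_term0_bound) blast
  let ?M = "\<lambda>i. B * ((real i + 1) ^ Suc m * (1 / 2) ^ i)"
  have M: "\<bar>real (Suc i) ^ m * centroid_prob0 n i\<bar> \<le> ?M i" for n i
  proof -
    have "real (Suc i) ^ m * centroid_prob0 n i \<le> real (Suc i) ^ m * (B * ((real i + 1) * (1 / 2) ^ i))"
      using centroid_prob0_bounds[of n i] B(3)[of n i] by (intro mult_mono) auto
    also have "\<dots> = ?M i" by (simp add: mult_ac add.commute)
    finally show ?thesis using centroid_prob0_bounds(1)[of n i] by simp
  qed
  have sM: "summable ?M" by (intro summable_mult summable_poly_geometric)
  have lim: "(\<lambda>n. real (Suc i) ^ m * centroid_prob0 n i) \<longlonglongrightarrow> real (Suc i) ^ m * limit_prob \<alpha> (Suc i)" for i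
    by (intro tendsto_mult_left centroid_prob0_lim)
  show "(\<lambda>n. \<Sum>i. real (Suc i) ^ m * centroid_prob0 n i) \<longlonglongrightarrow>
      (\<Sum>i. real (Suc i) ^ m * limit_prob \<alpha> (Suc i))"
    by (rule tannery[OF lim M sM])
  have "\<bar>real (Suc i) ^ m * limit_prob \<alpha> (Suc i)\<bar> \<le> ?M i" for i
    using tendsto_rabs[OF lim] M by (rule LIMSEQ_le_const2[OF _ exI, OF _ allI, OF _ impI])
  then show "summable (\<lambda>i. real (Suc i) ^ m * limit_prob \<alpha> (Suc i))"
    by (intro summable_comparison_test'[OF sM, of 0]) simp
qed

end

theorem lemma13:
  fixes c1 c2 \<alpha> :: real and m :: nat
  assumes "very_simple c1 c2 \<alpha>" and "m \<ge> 1"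
  shows "integrable (measure_pmf (limit_label \<alpha>)) (\<lambda>k. real k ^ m) \<and>
         (\<lambda>n. measure_pmf.expectation (random_tree c1 c2 n) (\<lambda>T. real (centroid_label T) ^ m))
            \<longlonglongrightarrow> measure_pmf.expectation (limit_label \<alpha>) (\<lambda>k. real k ^ m)"
proof -
  interpret very_simple_family c1 c2 \<alpha> by unfold_locales (rule assms(1))
  note limit = limit_moment[OF centroid_moment_lim(1)]
  have "(\<lambda>n. measure_pmf.expectation (random_tree c1 c2 n) (\<lambda>T. real (centroid_label T) ^ m))
      \<longlonglongrightarrow> measure_pmf.expectation (limit_label \<alpha>) (\<lambda>k. real k ^ m)"
    unfolding limit(2)
    by (rule Lim_transform_eventually[OF centroid_moment_lim(2)])
       (use eventually_ge_at_top[of 1] in \<open>eventually_elim, simp add: centroid_moment\<close>)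
  with limit(1) show ?thesis ..
qed

end
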